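(* Let $(E,X,\pi,\|\cdot\|)$ be a bundle of Banach algebras such that for every $x\in X$ the fiber $\pi^{-1}(x)$ is (isometrically) isomorphic to, and is identified with, $\mathcal{A}_d/\overline{I_x}$ for some graded ideal $I_x\subset\mathcal{P}_d$. Suppose that for each $i=1,\dots,d$ the section $S_i:X\to E$, $x\mapsto s_i+\overline{I_x}$, is continuous. Then the map $\phi:X\to\mathcal{M}$ defined by $\phi(x)=p_{I_x}$ is continuous.
   Context: Fix a natural number $d\geq 1$; $e_1,\dots,e_d$ is the standard orthonormal basis of $\mathbb{C}^d$. The full Fock space $\mathcal{F}(\mathbb{C}^d)$ is the Hilbert direct sum of $(\mathbb{C}^d)^{\otimes k}$, $k\geq0$. The creation operators $s_j$ are the isometries $e_{i_1}\otimes\cdots\otimes e_{i_k}\mapsto e_j\otimes e_{i_1}\otimes\cdots\otimes e_{i_k}$. $\mathcal{P}_d$ is the unital algebra generated by $s_1,\dots,s_d$ (a free algebra on these generators), graded by $\mathcal{P}_d^k=\operatorname{span}\{s_{i_1}\cdots s_{i_k}\}$, and $\mathcal{A}_d$ is its operator-norm closure in $\mathcal{B}(\mathcal{F}(\mathbb{C}^d))$. Graded ideals are two-sided ideals of the form $I=\bigoplus_{k\geq1}I^k\subset\mathcal{P}_d$ with $I^k\subset\mathcal{P}_d^k$; $\overline{I}$ is the closure of $I$ in $\mathcal{A}_d$ and $\mathcal{A}_d/\overline{I}$ has the quotient norm. Let $Ev:\mathcal{P}_d\to\mathcal{F}(\mathbb{C}^d)$ be the linear map $s_{i_1}\cdots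 s_{i_k}\mapsto e_{i_1}\otimes\cdots\otimes e_{i_k}$; $p_I\in\mathcal{B}(\mathcal{F}(\mathbb{C}^d))$ is the orthogonal projection onto $Ev(I)^\perp$. $\mathcal{M}$ is the set of all such $p_I$ ($I$ a graded ideal), with the topology induced from the strong operator topology. A bundle of Banach algebras $(E,X,\pi,\|\cdot\|)$ consists of topological spaces $E,X$, a continuous open surjection $\pi:E\to X$, the structure of an algebra on each fiber $\pi^{-1}(x)$, and a function $\|\cdot\|:E\to\mathbb{R}_{\geq0}$ restricting on each fiber to a norm that makes it a Banach algebra, such that: (A1) $E\times_XE\to E$, $(e_1,e_2)\mapsto e_1+e_2$ is continuous; (A2) $E\times\mathbb{C}\to E$, $(e,\lambda)\mapsto\lambda e$ is continuous; (A3) $E\times_XE\to E$, $(e_1,e_2)\mapsto e_1e_2$ is continuous; (A4) for each $x\in X$, the sets $\{e\in E:\pi(e)\in U,\ \|e\|<\varepsilon\}$, with $U$ an open neighborhood of $x$ and $\varepsilon>0$, form a local base at the zero vector $0_x$ of $\pi^{-1}(x)$; (A5) $\|\cdot\|$ is continuous on $E$. *)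

theory Defs
  imports "HOL-Analysis.Analysis" "HOL-Library.Set_Algebras"
begin

section \<open>The Hilbert space of square-summable families\<close>

typedef 'a ell2 = "{f :: 'a \<Rightarrow> complex. (\<lambda>x. (cmod (f x))\<^sup>2) summable_on UNIV}"
  morphisms ell2_apply Abs_ell2
  by (rule exI[of _ "\<lambda>_. 0"]) simp

setup_lifting type_definition_ell2

lemma ell2_eqI: "(\<And>x. ell2_apply f x = ell2_apply g x) \<Longrightarrow> f = g"
  by (metis ell2_apply_inject ext)

lemma ell2_summable: "(\<lambda>x. (cmod (ell2_apply f x))\<^sup>2) summable_on UNIV"
  using ell2_apply[of f] by simp

lemma summable_on_comparison_real:
  fixes f g :: "'a \<Rightarrow> real"
  assumes "g summable_on UNIV" "\<And>x. 0 \<le> f x" "\<And>x. f x \<le> g x"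
  shows "f summable_on UNIV"
  using summable_on_comparison_test[OF assms(1), of f] assms(2,3) by auto

lemma ell2_summable_add:
  fixes f g :: "'a \<Rightarrow> complex"
  assumes "(\<lambda>x. (cmod (f x))\<^sup>2) summable_on UNIV" "(\<lambda>x. (cmod (g x))\<^sup>2) summable_on UNIV"
  shows "(\<lambda>x. (cmod (f x + g x))\<^sup>2) summable_on UNIV"
proof (rule summable_on_comparison_real)
  show "(\<lambda>x. 2 * (cmod (f x))\<^sup>2 + 2 * (cmod (g x))\<^sup>2) summable_on UNIV"
    by (intro summable_on_add summable_on_cmult_right assms)
  show "(cmod (f x + g x))\<^sup>2 \<le> 2 * (cmod (f x))\<^sup>2 + 2 * (cmod (g x))\<^sup>2" for x
  proof -
    have "(cmod (f x + g x))\<^sup>2 \<le> (cmod (f x) + cmod (g x))\<^sup>2"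
      by (intro power_mono norm_triangle_ineq) auto
    also have "\<dots> \<le> 2 * (cmod (f x))\<^sup>2 + 2 * (cmod (g x))\<^sup>2"
      using sum_squares_bound[of "cmod (f x)" "cmod (g x)"] by (simp add: power2_sum)
    finally show ?thesis .
  qed
qed auto

lemma ell2_summable_scale:
  fixes f :: "'a \<Rightarrow> complex"
  assumes "(\<lambda>x. (cmod (f x))\<^sup>2) summable_on UNIV"
  shows "(\<lambda>x. (cmod (c * f x))\<^sup>2) summable_on UNIV"
  using summable_on_cmult_right[OF assms, of "(cmod c)\<^sup>2"]
  by (simp add: norm_mult power_mult_distrib)

lemma ell2_summable_cinner: "(\<lambda>x. cnj (ell2_apply f x) * ell2_apply g x) summable_on UNIV"
proof (rule abs_summable_summable, rule abs_summable_product)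
  show "(\<lambda>x. norm (cnj (ell2_apply f x) * cnj (ell2_apply f x))) summable_on UNIV"
    using ell2_summable[of f] by (simp add: norm_mult power2_eq_square)
  show "(\<lambda>x. norm (ell2_apply g x * ell2_apply g x)) summable_on UNIV"
    using ell2_summable[of g] by (simp add: norm_mult power2_eq_square)
qed

instantiation ell2 :: (type) real_vector
begin
lift_definition zero_ell2 :: "'a ell2" is "\<lambda>_. 0" by simp
lift_definition plus_ell2 :: "'a ell2 \<Rightarrow> 'a ell2 \<Rightarrow> 'a ell2" is "\<lambda>f g x. f x + g x"
  by (rule ell2_summable_add)
lift_definition uminus_ell2 :: "'a ell2 \<Rightarrow> 'a ell2" is "\<lambda>f x. - f x" by simp
lift_definition minus_ell2 :: "'a ell2 \<Rightarrow> 'a ell2 \<Rightarrow> 'a ell2" is "\<lambda>f g x. f x - g x"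
  using ell2_summable_add[where g = "\<lambda>x. - _ x"] by fastforce
lift_definition scaleR_ell2 :: "real \<Rightarrow> 'a ell2 \<Rightarrow> 'a ell2" is "\<lambda>r f x. complex_of_real r * f x"
  by (rule ell2_summable_scale)
instance
  by standard (transfer; simp add: fun_eq_iff algebra_simps)+
end

lift_definition scaleC :: "complex \<Rightarrow> 'a ell2 \<Rightarrow> 'a ell2" is "\<lambda>c f x. c * f x"
  by (rule ell2_summable_scale)

definition cinner :: "'a ell2 \<Rightarrow> 'a ell2 \<Rightarrow> complex" where
  "cinner f g = (\<Sum>\<^sub>\<infinity>x. cnj (ell2_apply f x) * ell2_apply g x)"

lemma cinner_add_right: "cinner f (g + h) = cinner f g + cinner f h"
  unfolding cinner_def plus_ell2.rep_eq
  by (simp add: distrib_left infsum_add ell2_summable_cinner)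

lemma cinner_scaleC_right: "cinner f (scaleC c g) = c * cinner f g"
  unfolding cinner_def scaleC.rep_eq
  by (simp add: mult.left_commute[of _ c] infsum_cmult_right')

lemma cinner_commute: "cinner g f = cnj (cinner f g)"
  unfolding cinner_def by (simp flip: infsum_cnj add: mult.commute)

lemma scaleR_scaleC: "r *\<^sub>R f = scaleC (complex_of_real r) f"
  by transfer simp

lemma Re_cinner_self: "Re (cinner f f) = (\<Sum>\<^sub>\<infinity>x. (cmod (ell2_apply f x))\<^sup>2)"
proof -
  have "Re (cnj z * z) = (cmod z)\<^sup>2" for z
    unfolding cmod_power2 by (simp add: power2_eq_square)
  then show ?thesis
    unfolding cinner_def infsum_Re[OF ell2_summable_cinner, symmetric] by presburger
qed

instantiation ell2 :: (type) real_inner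
begin
definition inner_ell2 :: "'a ell2 \<Rightarrow> 'a ell2 \<Rightarrow> real" where
  "inner_ell2 f g = Re (cinner f g)"
definition norm_ell2 :: "'a ell2 \<Rightarrow> real" where
  "norm_ell2 f = sqrt (inner f f)"
definition dist_ell2 :: "'a ell2 \<Rightarrow> 'a ell2 \<Rightarrow> real" where
  "dist_ell2 f g = norm (f - g)"
definition sgn_ell2 :: "'a ell2 \<Rightarrow> 'a ell2" where
  "sgn_ell2 f = inverse (norm f) *\<^sub>R f"
definition uniformity_ell2 :: "('a ell2 \<times> 'a ell2) filter" where
  "uniformity_ell2 = (INF e\<in>{0<..}. principal {(x, y). dist x y < e})"
definition open_ell2 :: "'a ell2 set \<Rightarrow> bool" where
  "open_ell2 U \<longleftrightarrow> (\<forall>x\<in>U. eventually (\<lambda>(x', y). x' = x \<longrightarrow> y \<in> U) uniformity)"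
instance
proof
  fix f g h :: "'a ell2" and r :: real and U :: "'a ell2 set"
  have self: "inner f f = (\<Sum>\<^sub>\<infinity>x. (cmod (ell2_apply f x))\<^sup>2)" for f :: "'a ell2"
    unfolding inner_ell2_def by (rule Re_cinner_self)
  show "dist f g = norm (f - g)" by (rule dist_ell2_def)
  show "sgn f = inverse (norm f) *\<^sub>R f" by (rule sgn_ell2_def)
  show "uniformity = (INF e\<in>{0<..}. principal {(x, y :: 'a ell2). dist x y < e})"
    by (rule uniformity_ell2_def)
  show "open U \<longleftrightarrow> (\<forall>x\<in>U. eventually (\<lambda>(x', y). x' = x \<longrightarrow> y \<in> U) uniformity)"
    by (rule open_ell2_def)
  show sym: "inner f g = inner g f" for f g :: "'a ell2"
    unfolding inner_ell2_def using cinner_commute[of f g] by simp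
  show "inner (f + g) h = inner f h + inner g h"
    unfolding sym[of _ h] by (simp add: inner_ell2_def cinner_add_right)
  show "inner (r *\<^sub>R f) g = r * inner f g"
    unfolding sym[of _ g] by (simp add: inner_ell2_def scaleR_scaleC cinner_scaleC_right)
  show "0 \<le> inner f f" unfolding self by (rule infsum_nonneg) simp
  show "inner f f = 0 \<longleftrightarrow> f = 0"
  proof
    assume "inner f f = 0"
    then have "(cmod (ell2_apply f x))\<^sup>2 = 0" for x
      using nonneg_infsum_le_0D[of "\<lambda>x. (cmod (ell2_apply f x))\<^sup>2" UNIV x] ell2_summable[of f]
      unfolding self by auto
    then show "f = 0" by (intro ell2_eqI) (simp add: zero_ell2.rep_eq)
  qed (simp add: self zero_ell2.rep_eq)
  show "norm f = sqrt (inner f f)" by (rule norm_ell2_def)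
qed
end

lemma norm_ell2_power2: "(norm f)\<^sup>2 = (\<Sum>\<^sub>\<infinity>x. (cmod (ell2_apply f x))\<^sup>2)"
  unfolding power2_norm_eq_inner[of f] inner_ell2_def by (rule Re_cinner_self)

lemma sum_cmod_le_norm_ell2:
  assumes "finite F" shows "(\<Sum>x\<in>F. (cmod (ell2_apply f x))\<^sup>2) \<le> (norm f)\<^sup>2"
  unfolding norm_ell2_power2 by (rule finite_sum_le_infsum[OF ell2_summable assms]) auto

lemma cmod_ell2_apply_le: "cmod (ell2_apply f x) \<le> norm f"
  using sum_cmod_le_norm_ell2[of "{x}" f] by (simp add: power2_le_iff_abs_le)

lemma norm_scaleC: "norm (scaleC c f) = cmod c * norm f"
proof -
  have "(norm (scaleC c f))\<^sup>2 = (cmod c * norm f)\<^sup>2"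
    by (simp add: norm_ell2_power2 scaleC.rep_eq norm_mult power_mult_distrib infsum_cmult_right')
  then show ?thesis by simp
qed

instance ell2 :: (type) banach
proof
  fix X :: "nat \<Rightarrow> 'a ell2"
  assume X: "Cauchy X"
  have "Cauchy (\<lambda>n. ell2_apply (X n) x)" for x
    unfolding Cauchy_def
  proof (intro allI impI)
    fix e :: real assume "e > 0"
    then obtain N where N: "\<And>m n. m \<ge> N \<Longrightarrow> n \<ge> N \<Longrightarrow> dist (X m) (X n) < e"
      using X unfolding Cauchy_def by blast
    have "dist (ell2_apply (X m) x) (ell2_apply (X n) x) \<le> dist (X m) (X n)" for m n
      using cmod_ell2_apply_le[of "X m - X n" x] by (simp add: dist_norm minus_ell2.rep_eq)
    then show "\<exists>M. \<forall>m\<ge>M. \<forall>n\<ge>M. dist (ell2_apply (X m) x) (ell2_apply (X n) x) < e"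
      using N by (meson le_less_trans)
  qed
  then have "\<exists>l. (\<lambda>n. ell2_apply (X n) x) \<longlonglongrightarrow> l" for x
    using convergent_eq_Cauchy convergent_def by blast
  then obtain l where l: "\<And>x. (\<lambda>n. ell2_apply (X n) x) \<longlonglongrightarrow> l x" by metis
  have bound: "(\<Sum>x\<in>F. (cmod (l x - ell2_apply (X n) x))\<^sup>2) \<le> e\<^sup>2"
    if F: "finite F" and N: "\<And>m. m \<ge> N \<Longrightarrow> dist (X m) (X n) < e" for F n N e
  proof (rule Lim_bounded)
    show "(\<lambda>m. \<Sum>x\<in>F. (cmod (ell2_apply (X m) x - ell2_apply (X n) x))\<^sup>2)
        \<longlonglongrightarrow> (\<Sum>x\<in>F. (cmod (l x - ell2_apply (X n) x))\<^sup>2)"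
      by (intro tendsto_intros l)
    show "\<forall>m\<ge>N. (\<Sum>x\<in>F. (cmod (ell2_apply (X m) x - ell2_apply (X n) x))\<^sup>2) \<le> e\<^sup>2"
    proof (intro allI impI)
      fix m assume "m \<ge> N"
      have "(\<Sum>x\<in>F. (cmod (ell2_apply (X m) x - ell2_apply (X n) x))\<^sup>2) \<le> (norm (X m - X n))\<^sup>2"
        using sum_cmod_le_norm_ell2[OF F, of "X m - X n"] by (simp add: minus_ell2.rep_eq)
      also have "\<dots> \<le> e\<^sup>2"
        using N[OF \<open>m \<ge> N\<close>] by (intro power_mono) (auto simp: dist_norm)
      finally show "(\<Sum>x\<in>F. (cmod (ell2_apply (X m) x - ell2_apply (X n) x))\<^sup>2) \<le> e\<^sup>2" .
    qed
  qed
  have diff: "(\<lambda>x. (cmod (l x - ell2_apply (X n) x))\<^sup>2) summable_on UNIV"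
    if "\<And>m. m \<ge> N \<Longrightarrow> dist (X m) (X n) < e" for n N e
    by (rule nonneg_bdd_above_summable_on)
       (auto intro!: bdd_aboveI2[where M = "e\<^sup>2"] bound that)
  obtain N1 where N1: "\<And>m n. m \<ge> N1 \<Longrightarrow> n \<ge> N1 \<Longrightarrow> dist (X m) (X n) < 1"
    using X unfolding Cauchy_def by (metis zero_less_one)
  have "(\<lambda>x. (cmod ((l x - ell2_apply (X N1) x) + ell2_apply (X N1) x))\<^sup>2) summable_on UNIV"
    by (rule ell2_summable_add[OF diff ell2_summable]) (rule N1; simp)
  then have lsum: "(\<lambda>x. (cmod (l x))\<^sup>2) summable_on UNIV" by simp
  define L where "L = Abs_ell2 l"
  have L: "ell2_apply L = l" unfolding L_def using lsum by (simp add: Abs_ell2_inverse)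
  have "X \<longlonglongrightarrow> L"
    unfolding LIMSEQ_def
  proof (intro allI impI)
    fix r :: real assume "r > 0"
    then obtain N where N: "\<And>m n. m \<ge> N \<Longrightarrow> n \<ge> N \<Longrightarrow> dist (X m) (X n) < r / 2"
      using X unfolding Cauchy_def by (meson half_gt_zero)
    have "dist (X n) L < r" if n: "n \<ge> N" for n
    proof -
      have "(norm (L - X n))\<^sup>2 \<le> (r / 2)\<^sup>2"
        unfolding norm_ell2_power2 minus_ell2.rep_eq L
        by (rule infsum_le_finite_sums[OF diff[where N = N and e = "r / 2"] bound[where N = N and e = "r / 2"]])
           (use N n in auto)
      then have "norm (L - X n) \<le> r / 2" using \<open>r > 0\<close> by (simp add: power2_le_iff_abs_le)
      then show ?thesis using \<open>r > 0\<close> by (simp add: dist_norm norm_minus_commute)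
    qed
    then show "\<exists>no. \<forall>n\<ge>no. dist (X n) L < r" by blast
  qed
  then show "convergent X" unfolding convergent_def by blast
qed

global_interpretation ell2: vector_space scaleC
  by unfold_locales (transfer; simp add: fun_eq_iff algebra_simps)+

lemma bounded_linear_scaleC: "bounded_linear (scaleC c :: 'a ell2 \<Rightarrow> 'a ell2)"
proof (rule bounded_linear_intro[where K = "cmod c"])
  fix f g :: "'a ell2" and r :: real
  show "scaleC c (f + g) = scaleC c f + scaleC c g" by (rule ell2.scale_right_distrib)
  show "scaleC c (r *\<^sub>R f) = r *\<^sub>R scaleC c f"
    by (simp add: scaleR_scaleC mult.commute)
  show "norm (scaleC c f) \<le> norm f * cmod c" by (simp add: norm_scaleC)
qed

lift_definition ket :: "'a \<Rightarrow> 'a ell2" is "\<lambda>a x. if x = a then 1 else 0"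
proof -
  fix a :: 'a
  have "(\<lambda>x. (cmod (if x = a then 1 else 0))\<^sup>2) summable_on {a}" by simp
  then show "(\<lambda>x. (cmod (if x = a then 1 else 0))\<^sup>2) summable_on UNIV"
    by (rule summable_on_cong_neutral[THEN iffD1, rotated -1]) auto
qed

lemma cinner_0_right [simp]: "cinner f 0 = 0"
  using cinner_scaleC_right[of f 0 0] by simp

lemma cinner_ket: "cinner (ket a) f = ell2_apply f a"
proof -
  have "cinner (ket a) f = (\<Sum>\<^sub>\<infinity>x\<in>{a}. cnj (ell2_apply (ket a) x) * ell2_apply f x)"
    unfolding cinner_def by (rule infsum_cong_neutral) (auto simp: ket.rep_eq)
  then show ?thesis by (simp add: ket.rep_eq)
qed

definition orth_complement :: "'a ell2 set \<Rightarrow> 'a ell2 set" where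
  "orth_complement S = {f. \<forall>g\<in>S. cinner g f = 0}"

definition is_orth_proj :: "('a ell2 \<Rightarrow>\<^sub>L 'a ell2) \<Rightarrow> 'a ell2 set \<Rightarrow> bool" where
  "is_orth_proj p S \<longleftrightarrow> (\<forall>f. p f \<in> S \<and> f - p f \<in> orth_complement S)"

definition orth_proj :: "'a ell2 set \<Rightarrow> ('a ell2 \<Rightarrow>\<^sub>L 'a ell2)" where
  "orth_proj S = (THE p. is_orth_proj p S)"

lemma cinner_eq_0_if_inner:
  assumes "\<And>c. inner (scaleC c g) f = 0"
  shows "cinner g f = 0"
proof -
  have "inner (scaleC c g) f = Re (cnj c * cinner g f)" for c
    using cinner_commute[of "scaleC c g" f] cinner_commute[of g f]
    by (simp add: inner_ell2_def cinner_scaleC_right)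
  from assms[of 1] assms[of \<i>, unfolded this] this[of 1] show ?thesis
    by (simp add: complex_eq_iff)
qed

lemma hilbert_projection:
  fixes S :: "'a ell2 set"
  assumes S: "subspace S" "closed S"
  shows "\<exists>g\<in>S. \<forall>h\<in>S. inner h (f - g) = 0"
proof -
  define d where "d = (INF s\<in>S. norm (f - s))"
  have ne: "S \<noteq> {}" using subspace_0[OF S(1)] by auto
  have bdd: "bdd_below ((\<lambda>s. norm (f - s)) ` S)" by (rule bdd_belowI2[of _ 0]) simp
  have d_le: "d \<le> norm (f - s)" if "s \<in> S" for s
    unfolding d_def by (rule cINF_lower[OF bdd that])
  have d0: "0 \<le> d" unfolding d_def by (rule cINF_greatest[OF ne]) simp
  have "\<exists>s\<in>S. norm (f - s) < d + 1 / real (Suc n)" for n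
    using cINF_less_iff[OF ne bdd, of "d + 1 / real (Suc n)"] unfolding d_def by simp
  then obtain s where sS: "\<And>n. s n \<in> S" and s: "\<And>n. norm (f - s n) < d + 1 / real (Suc n)"
    by metis
  have sq: "(norm (f - s n))\<^sup>2 \<le> d\<^sup>2 + (2 * d + 1) / real (Suc n)" for n
  proof -
    have "(norm (f - s n))\<^sup>2 \<le> (d + 1 / real (Suc n))\<^sup>2"
      using s[of n] by (intro power_mono) auto
    also have "\<dots> = d\<^sup>2 + 2 * d / real (Suc n) + (1 / real (Suc n)) * (1 / real (Suc n))"
      by (simp add: power2_eq_square algebra_simps)
    also have "\<dots> \<le> d\<^sup>2 + 2 * d / real (Suc n) + 1 * (1 / real (Suc n))"
      by (intro add_left_mono mult_right_mono) auto
    finally show ?thesis by (simp add: add_divide_distrib)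
  qed
  have par: "(norm (s m - s n))\<^sup>2 \<le> 4 * (2 * d + 1) / real (Suc N)"
    if "m \<ge> N" "n \<ge> N" for m n N
  proof -
    have "(1/2) *\<^sub>R (s m + s n) \<in> S"
      by (intro subspace_scale subspace_add S sS)
    then have "d\<^sup>2 \<le> (norm (f - (1/2) *\<^sub>R (s m + s n)))\<^sup>2"
      using d_le d0 by (intro power_mono) auto
    moreover have "(norm (s m - s n))\<^sup>2 + 4 * (norm (f - (1/2) *\<^sub>R (s m + s n)))\<^sup>2
        = 2 * (norm (f - s m))\<^sup>2 + 2 * (norm (f - s n))\<^sup>2"
      unfolding power2_norm_eq_inner
      by (simp add: inner_diff_left inner_diff_right inner_add_left inner_add_right
          inner_commute algebra_simps)
    moreover have "(2 * d + 1) / real (Suc m) \<le> (2 * d + 1) / real (Suc N)"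
      and "(2 * d + 1) / real (Suc n) \<le> (2 * d + 1) / real (Suc N)"
      using that d0 by (auto intro!: divide_left_mono)
    ultimately show ?thesis using sq[of m] sq[of n] by linarith
  qed
  have "Cauchy s"
    unfolding Cauchy_def
  proof (intro allI impI)
    fix e :: real assume e: "e > 0"
    obtain N where N: "4 * (2 * d + 1) / e\<^sup>2 < real N" using reals_Archimedean2 by blast
    have "4 * (2 * d + 1) / real (Suc N) < e\<^sup>2"
      using N e d0 by (simp add: field_simps) (smt (verit) zero_less_power)
    then have "(norm (s m - s n))\<^sup>2 < e\<^sup>2" if "m \<ge> N" "n \<ge> N" for m n
      using par[OF that] by linarith
    then show "\<exists>M. \<forall>m\<ge>M. \<forall>n\<ge>M. dist (s m) (s n) < e"
      using e by (metis dist_norm less_imp_le power2_less_imp_less)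
  qed
  then obtain g where g: "s \<longlonglongrightarrow> g" using Cauchy_convergent convergent_def by blast
  have gS: "g \<in> S" using closed_sequentially[OF S(2) _ g] sS by blast
  have "norm (f - g) \<le> d"
  proof (rule LIMSEQ_le)
    show "(\<lambda>n. norm (f - s n)) \<longlonglongrightarrow> norm (f - g)" by (intro tendsto_intros g)
    show "(\<lambda>n. d + 1 / real (Suc n)) \<longlonglongrightarrow> d"
      using tendsto_add[OF tendsto_const LIMSEQ_inverse_real_of_nat, of d]
      by (simp add: inverse_eq_divide)
    show "\<exists>N. \<forall>n\<ge>N. norm (f - s n) \<le> d + 1 / real (Suc n)" using s less_imp_le by blast
  qed
  have "inner h (f - g) = 0" if "h \<in> S" for h
  proof (cases "h = 0")
    case False
    define t where "t = inner h (f - g) / (norm h)\<^sup>2"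
    have "g + t *\<^sub>R h \<in> S" by (intro subspace_add subspace_scale S gS that)
    then have "norm (f - g) \<le> norm (f - (g + t *\<^sub>R h))"
      using d_le \<open>norm (f - g) \<le> d\<close> by force
    then have "(norm (f - g))\<^sup>2 \<le> (norm ((f - g) - t *\<^sub>R h))\<^sup>2"
      by (intro power_mono) (auto simp: algebra_simps)
    also have "\<dots> = (norm (f - g))\<^sup>2 - 2 * t * inner h (f - g) + t\<^sup>2 * (norm h)\<^sup>2"
      unfolding power2_norm_eq_inner
      by (simp add: inner_diff_left inner_diff_right inner_commute algebra_simps power2_eq_square)
    also have "\<dots> = (norm (f - g))\<^sup>2 - (inner h (f - g))\<^sup>2 / (norm h)\<^sup>2"
      using False by (simp add: t_def field_simps power2_eq_square)
    finally have "(inner h (f - g))\<^sup>2 / (norm h)\<^sup>2 \<le> 0" by simp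
    then show ?thesis using False
      by (metis divide_eq_0_iff divide_nonneg_nonneg norm_eq_zero order_antisym power_eq_0_iff zero_le_power2)
  qed simp
  with gS show ?thesis by blast
qed

lemma inner_eq_0_if_cinner: "cinner g f = 0 \<Longrightarrow> inner g f = 0"
  by (simp add: inner_ell2_def)

lemma cinner_diff_right: "cinner f (g - h) = cinner f g - cinner f h"
  using cinner_add_right[of f "g - h" h] by simp

lemma is_orth_proj_unique:
  assumes "is_orth_proj p S" "is_orth_proj q S" "ell2.subspace S"
  shows "p = q"
proof (rule blinfun_eqI)
  fix f
  have S: "p f - q f \<in> S"
    using assms by (auto simp: is_orth_proj_def ell2.subspace_diff)
  have "cinner (p f - q f) (f - q f) = 0" "cinner (p f - q f) (f - p f) = 0"
    using assms S by (auto simp: is_orth_proj_def orth_complement_def)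
  then have "cinner (p f - q f) ((f - q f) - (f - p f)) = 0" by (simp only: cinner_diff_right[of _ "f - q f" "f - p f"]) simp
  then have "inner (p f - q f) (p f - q f) = 0" by (simp add: inner_ell2_def)
  then show "p f = q f" by simp
qed

lemma orth_proj_exists:
  assumes S: "ell2.subspace S" and "closed S"
  shows "\<exists>p. is_orth_proj p S"
proof -
  have rS: "subspace S"
    using S by (auto simp: subspace_def ell2.subspace_def scaleR_scaleC)
  have "\<exists>g. g \<in> S \<and> f - g \<in> orth_complement S" for f
  proof -
    obtain g where g: "g \<in> S" "\<And>h. h \<in> S \<Longrightarrow> inner h (f - g) = 0"
      using hilbert_projection[OF rS \<open>closed S\<close>, of f] by blast
    have "cinner h (f - g) = 0" if "h \<in> S" for h
      by (intro cinner_eq_0_if_inner g ell2.subspace_scale[OF S that])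
    with g show ?thesis by (auto simp: orth_complement_def)
  qed
  then obtain P where P: "\<And>f. P f \<in> S" "\<And>f. f - P f \<in> orth_complement S" by metis
  have orth: "inner h (f - P f) = 0" if "h \<in> S" for f h
    using P(2)[of f] that by (auto simp: orth_complement_def intro: inner_eq_0_if_cinner)
  have uniq: "P f = g" if "g \<in> S" "\<And>h. h \<in> S \<Longrightarrow> inner h (f - g) = 0" for f g
  proof -
    have *: "P f - g \<in> S" using P that rS by (simp add: subspace_diff)
    have "inner (P f - g) ((f - g) - (f - P f)) = 0"
      unfolding inner_diff_right[of "P f - g" "f - g"] using that(2)[OF *] orth[OF *] by simp
    then show ?thesis by simp
  qed
  have "bounded_linear P"
  proof (rule bounded_linear_intro[where K = 1])
    fix f g :: "'a ell2" and r :: real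
    show "P (f + g) = P f + P g"
    proof (rule uniq)
      fix h assume "h \<in> S"
      have "inner h (f + g - (P f + P g)) = inner h (f - P f) + inner h (g - P g)"
        by (simp add: inner_diff_right inner_add_right)
      then show "inner h (f + g - (P f + P g)) = 0" using orth \<open>h \<in> S\<close> by simp
    qed (intro subspace_add rS P)
    show "P (r *\<^sub>R f) = r *\<^sub>R P f"
    proof (rule uniq)
      fix h assume "h \<in> S"
      have "inner h (r *\<^sub>R f - r *\<^sub>R P f) = r * inner h (f - P f)"
        by (simp add: inner_diff_right algebra_simps)
      then show "inner h (r *\<^sub>R f - r *\<^sub>R P f) = 0" using orth \<open>h \<in> S\<close> by simp
    qed (intro subspace_scale rS P)
    have "(norm (P f))\<^sup>2 = inner (P f) f"
      using orth[OF P(1), of f f] by (simp add: power2_norm_eq_inner inner_diff_right)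
    also have "\<dots> \<le> norm (P f) * norm f" by (rule norm_cauchy_schwarz)
    finally have "norm (P f) * norm (P f) \<le> norm (P f) * norm f" by (simp add: power2_eq_square)
    then show "norm (P f) \<le> norm f * 1"
      by (cases "P f = 0") auto
  qed
  then have "is_orth_proj (Blinfun P) S"
    unfolding is_orth_proj_def using P by (simp add: bounded_linear_Blinfun_apply)
  then show ?thesis ..
qed

lemma is_orth_proj_orth_proj:
  assumes "ell2.subspace S" "closed S"
  shows "is_orth_proj (orth_proj S) S"
  unfolding orth_proj_def
  using orth_proj_exists[OF assms] is_orth_proj_unique[OF _ _ assms(1)] by (metis (mono_tags) theI)

lemma subspace_orth_complement: "ell2.subspace (orth_complement S)"
  by (auto simp: ell2.subspace_def orth_complement_def cinner_add_right cinner_scaleC_right)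

lemma closed_orth_complement: "closed (orth_complement S)"
proof -
  have "orth_complement S = (\<Inter>g\<in>S. \<Inter>c. {f. inner (scaleC c g) f = 0})"
  proof (intro equalityI subsetI)
    fix f assume f: "f \<in> orth_complement S"
    have "cinner (scaleC c g) f = 0" if "g \<in> S" for c g
      using f that cinner_commute[of "scaleC c g" f] cinner_commute[of g f]
      by (auto simp: orth_complement_def cinner_scaleC_right)
    then show "f \<in> (\<Inter>g\<in>S. \<Inter>c. {f. inner (scaleC c g) f = 0})"
      by (simp add: inner_eq_0_if_cinner)
  qed (auto simp: orth_complement_def intro: cinner_eq_0_if_inner)
  moreover have "closed {f. inner (scaleC c g) f = 0}" for c and g :: "'a ell2"
    by (intro closed_Collect_eq continuous_intros)
  ultimately show ?thesis by (auto intro!: closed_INT)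
qed

definition op_scaleC :: "complex \<Rightarrow> ('a ell2 \<Rightarrow>\<^sub>L 'a ell2) \<Rightarrow> ('a ell2 \<Rightarrow>\<^sub>L 'a ell2)" where
  "op_scaleC c T = Blinfun (scaleC c) o\<^sub>L T"

lemma op_scaleC_apply [simp]: "blinfun_apply (op_scaleC c T) f = scaleC c (blinfun_apply T f)"
  by (simp add: op_scaleC_def bounded_linear_Blinfun_apply bounded_linear_scaleC)

global_interpretation ell2_op: vector_space op_scaleC
  by unfold_locales
     (auto intro!: blinfun_eqI simp: blinfun.add_left ell2.scale_left_distrib
        ell2.scale_right_distrib)


section \<open>The full Fock space\<close>

text \<open>
  The index type \<open>'n\<close> plays the role of \<open>{1,\<dots>,d}\<close>, so \<open>d = CARD('n) \<ge> 1\<close>.  The words of length \<open>k\<close>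
  label the orthonormal basis \<open>e\<^bsub>i\<^sub>1\<^esub> \<otimes> \<dots> \<otimes> e\<^bsub>i\<^sub>k\<^esub>\<close> of the \<open>k\<close>-th tensor power of \<open>\<complex>\<^sup>d\<close>, whence
  the Hilbert direct sum of all tensor powers is the space of square-summable families over
  all words; \<open>ket [i\<^sub>1, \<dots>, i\<^sub>k]\<close> is the basis vector above.

  Elements of \<open>'n fock_op\<close> are only required to be real-linear.  All operators used here are complex
  linear (cf. \<open>op_alg_scaleC\<close>), and the operator norm and the strong operator topology do not depend on
  the scalar field.
\<close>

type_synonym 'n fock = "'n list ell2"
type_synonym 'n fock_op = "'n fock \<Rightarrow>\<^sub>L 'n fock"

lift_definition creation_fun :: "'n \<Rightarrow> 'n fock \<Rightarrow> 'n fock" is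
  "\<lambda>j f w. case w of [] \<Rightarrow> 0 | i # v \<Rightarrow> if i = j then f v else 0"
proof -
  fix j :: 'n and f :: "'n list \<Rightarrow> complex"
  let ?g = "\<lambda>w. (cmod (case w of [] \<Rightarrow> 0 | i # v \<Rightarrow> if i = j then f v else 0))\<^sup>2"
  assume "(\<lambda>w. (cmod (f w))\<^sup>2) summable_on UNIV"
  then have "?g summable_on range ((#) j)"
    by (subst summable_on_reindex) (auto simp: o_def)
  then show "?g summable_on UNIV"
    by (rule summable_on_cong_neutral[THEN iffD1, rotated -1]) (auto split: list.splits)
qed

lemma norm_creation_fun: "norm (creation_fun j f) = norm f"
proof -
  let ?g = "\<lambda>w. (cmod (ell2_apply (creation_fun j f) w))\<^sup>2"
  have "infsum ?g UNIV = infsum ?g (range ((#) j))"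
    by (rule infsum_cong_neutral) (auto simp: creation_fun.rep_eq split: list.splits)
  also have "\<dots> = (\<Sum>\<^sub>\<infinity>w. (cmod (ell2_apply f w))\<^sup>2)"
    by (subst infsum_reindex) (auto simp: o_def creation_fun.rep_eq)
  finally have "(norm (creation_fun j f))\<^sup>2 = (norm f)\<^sup>2"
    by (simp add: norm_ell2_power2)
  then show ?thesis by simp
qed

lift_definition creation :: "'n \<Rightarrow> 'n fock_op" is creation_fun
proof (rule bounded_linear_intro[where K = 1])
  fix j :: 'n and f g :: "'n fock" and r :: real
  show "creation_fun j (f + g) = creation_fun j f + creation_fun j g"
    by transfer (auto simp: fun_eq_iff split: list.splits)
  show "creation_fun j (r *\<^sub>R f) = r *\<^sub>R creation_fun j f"
    by transfer (auto simp: fun_eq_iff split: list.splits)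
  show "norm (creation_fun j f) \<le> norm f * 1" by (simp add: norm_creation_fun)
qed

lemma creation_ket: "creation j (ket w) = ket (j # w)"
  unfolding creation.rep_eq by transfer (auto simp: fun_eq_iff split: list.splits)

lemma norm_creation: "norm (creation j f) = norm f"
  by (simp add: creation.rep_eq norm_creation_fun)

lemma creation_scaleC: "creation j (scaleC c f) = scaleC c (creation j f)"
  unfolding creation.rep_eq by transfer (auto simp: fun_eq_iff split: list.splits)

primrec word_op :: "'n list \<Rightarrow> 'n fock_op" where
  "word_op [] = id_blinfun"
| "word_op (j # w) = creation j o\<^sub>L word_op w"

definition unital_subalgebra :: "'n fock_op set \<Rightarrow> bool" where
  "unital_subalgebra B \<longleftrightarrow>
     ell2_op.subspace B \<and> id_blinfun \<in> B \<and> (\<forall>S\<in>B. \<forall>T\<in>B. S o\<^sub>L T \<in> B)"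

definition poly_alg :: "'n fock_op set" where
  "poly_alg = unital_subalgebra hull range creation"

definition poly_homog :: "nat \<Rightarrow> 'n fock_op set" where
  "poly_homog k = ell2_op.span (word_op ` {w. length w = k})"

definition op_alg :: "'n fock_op set" where
  "op_alg = closure poly_alg"

text \<open>
  Since \<open>word_op w (ket []) = ket w\<close>, evaluation at the vacuum vector \<open>ket []\<close> is the linear map
  sending each monomial to the corresponding basis vector; see \<open>Ev_linear\<close>, \<open>Ev_word_op\<close> and
  \<open>Ev_unique\<close> below.
\<close>

definition Ev :: "'n fock_op \<Rightarrow> 'n fock" where
  "Ev T = T (ket [])"

lemma word_op_append: "word_op (v @ w) = word_op v o\<^sub>L word_op w"
  by (induction v) (auto intro!: blinfun_eqI)

lemma word_op_scaleC: "word_op w (scaleC c f) = scaleC c (word_op w f)"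
  by (induction w) (auto simp: creation_scaleC)

lemma span_scaleC:
  assumes "T \<in> ell2_op.span (range word_op)"
  shows "T (scaleC c f) = scaleC c (T f)"
  using assms
  by (induction rule: ell2_op.span_induct_alt)
     (auto simp: blinfun.add_left word_op_scaleC ell2.scale_right_distrib mult.commute)

lemma poly_alg_eq_span: "(poly_alg :: 'n fock_op set) = ell2_op.span (range word_op)"
proof
  let ?B = "ell2_op.span (range word_op) :: 'n fock_op set"
  have mult1: "word_op w o\<^sub>L T \<in> ?B" if "T \<in> ?B" for w T
    using that
  proof (induction rule: ell2_op.span_induct_alt)
    case base
    have "word_op w o\<^sub>L 0 = 0" by (rule blinfun_eqI) (simp add: blinfun.zero_right)
    then show ?case by (simp add: ell2_op.span_zero)
  next
    case (step c S T)
    then obtain v where v: "S = word_op v" by auto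
    have "word_op w o\<^sub>L (op_scaleC c S + T) = op_scaleC c (word_op (w @ v)) + (word_op w o\<^sub>L T)"
      by (rule blinfun_eqI)
         (simp add: v word_op_append blinfun.add_left blinfun.add_right word_op_scaleC)
    then show ?case
      using step by (simp add: ell2_op.span_add ell2_op.span_scale ell2_op.span_base)
  qed
  have mult: "S o\<^sub>L T \<in> ?B" if "S \<in> ?B" "T \<in> ?B" for S T
    using that(1)
  proof (induction rule: ell2_op.span_induct_alt)
    case base
    have "0 o\<^sub>L T = 0" by (rule blinfun_eqI) simp
    then show ?case by (simp add: ell2_op.span_zero)
  next
    case (step c R S)
    have "(op_scaleC c R + S) o\<^sub>L T = op_scaleC c (R o\<^sub>L T) + (S o\<^sub>L T)"
      by (rule blinfun_eqI) (simp add: blinfun.add_left)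
    moreover have "R o\<^sub>L T \<in> ?B" using mult1[OF that(2)] step by auto
    ultimately show ?case using step by (simp add: ell2_op.span_add ell2_op.span_scale)
  qed
  have "creation j \<in> ?B" for j
  proof -
    have "word_op [j] = creation j" by (auto intro!: blinfun_eqI)
    then show ?thesis by (metis ell2_op.span_base rangeI)
  qed
  moreover have "id_blinfun \<in> ?B" by (metis ell2_op.span_base rangeI word_op.simps(1))
  ultimately show "poly_alg \<subseteq> ?B"
    unfolding poly_alg_def using mult
    by (intro hull_minimal) (auto simp: unital_subalgebra_def ell2_op.subspace_span)
  show "?B \<subseteq> poly_alg"
    unfolding poly_alg_def hull_def
  proof (rule Inter_greatest)
    fix B assume "B \<in> {t. unital_subalgebra t \<and> range creation \<subseteq> (t :: 'n fock_op set)}"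
    then have B: "unital_subalgebra B" "\<And>j. creation j \<in> B" by auto
    have "word_op w \<in> B" for w
      by (induction w) (use B in \<open>auto simp: unital_subalgebra_def\<close>)
    then show "?B \<subseteq> B"
      using B(1) by (intro ell2_op.span_minimal) (auto simp: unital_subalgebra_def)
  qed
qed

lemma Ev_word_op: "Ev (word_op w) = ket w"
  unfolding Ev_def by (induction w) (auto simp: creation_ket)

lemma Ev_linear: "Vector_Spaces.linear op_scaleC scaleC Ev"
  by unfold_locales (auto simp: Ev_def blinfun.add_left)

lemma Ev_unique:
  fixes L :: "'n fock_op \<Rightarrow> 'n fock"
  assumes "\<And>S T. S \<in> poly_alg \<Longrightarrow> T \<in> poly_alg \<Longrightarrow> L (S + T) = L S + L T"
    and "\<And>c T. T \<in> poly_alg \<Longrightarrow> L (op_scaleC c T) = scaleC c (L T)"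
    and "\<And>w. L (word_op w) = ket w"
    and "T \<in> poly_alg"
  shows "L T = Ev T"
proof -
  have sub: "ell2_op.subspace (poly_alg :: 'n fock_op set)"
    unfolding poly_alg_eq_span by (rule ell2_op.subspace_span)
  have "T \<in> poly_alg \<and> L T = Ev T"
    using assms(4) unfolding poly_alg_eq_span
  proof (induction rule: ell2_op.span_induct_alt)
    case base
    show ?case
      using assms(2)[of 0 0] ell2_op.subspace_0[OF sub] by (simp add: Ev_def flip: poly_alg_eq_span)
  next
    case (step c S T)
    then obtain w where w: "S = word_op w" by auto
    have S: "S \<in> poly_alg" using w by (simp add: poly_alg_eq_span ell2_op.span_base)
    have T: "T \<in> poly_alg" using step by (simp add: poly_alg_eq_span)
    have cS: "op_scaleC c S \<in> poly_alg" using S ell2_op.subspace_scale[OF sub] by blast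
    have "L (op_scaleC c S + T) = scaleC c (L S) + L T"
      by (simp add: assms(1)[OF cS T] assms(2)[OF S])
    also have "\<dots> = scaleC c (Ev S) + Ev T"
      using step w by (simp add: assms(3) Ev_word_op)
    also have "\<dots> = Ev (op_scaleC c S + T)" by (simp add: Ev_def blinfun.add_left)
    finally show ?case
      using ell2_op.subspace_add[OF sub cS T] by (simp flip: poly_alg_eq_span)
  qed
  then show ?thesis ..
qed


section \<open>Graded ideals and their projections\<close>

definition two_sided_ideal :: "'n fock_op set \<Rightarrow> bool" where
  "two_sided_ideal I \<longleftrightarrow> I \<subseteq> poly_alg \<and> ell2_op.subspace I \<and>
     (\<forall>T\<in>poly_alg. \<forall>S\<in>I. T o\<^sub>L S \<in> I \<and> S o\<^sub>L T \<in> I)"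

text \<open>
  The homogeneous components are linearly independent, so the sum of the \<open>J k\<close>, which is the span of
  their union, is automatically direct.
\<close>

definition graded_ideal :: "'n fock_op set \<Rightarrow> bool" where
  "graded_ideal I \<longleftrightarrow> two_sided_ideal I \<and>
     (\<exists>J. (\<forall>k\<ge>1. ell2_op.subspace (J k) \<and> J k \<subseteq> poly_homog k) \<and>
          I = ell2_op.span (\<Union>k\<in>{1..}. J k))"

definition ideal_proj :: "'n fock_op set \<Rightarrow> 'n fock_op" where
  "ideal_proj I = orth_proj (orth_complement (Ev ` I))"

lemma is_orth_proj_ideal_proj: "is_orth_proj (ideal_proj I) (orth_complement (Ev ` I))"
  unfolding ideal_proj_def
  by (rule is_orth_proj_orth_proj[OF subspace_orth_complement closed_orth_complement])

definition ideal_proj_space :: "'n fock_op topology" where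
  "ideal_proj_space =
     subtopology strong_operator_topology (ideal_proj ` {I. graded_ideal I})"


section \<open>Banach algebras and their bundles\<close>

record 'e normed_alg =
  carr :: "'e set"
  add :: "'e \<Rightarrow> 'e \<Rightarrow> 'e"
  zer :: 'e
  scal :: "complex \<Rightarrow> 'e \<Rightarrow> 'e"
  mul :: "'e \<Rightarrow> 'e \<Rightarrow> 'e"
  nrm :: "'e \<Rightarrow> real"

locale banach_algebra =
  fixes A :: "'e normed_alg"
  assumes zer_closed: "zer A \<in> carr A"
    and add_closed: "\<lbrakk>a \<in> carr A; b \<in> carr A\<rbrakk> \<Longrightarrow> add A a b \<in> carr A"
    and scal_closed: "a \<in> carr A \<Longrightarrow> scal A c a \<in> carr A"
    and mul_closed: "\<lbrakk>a \<in> carr A; b \<in> carr A\<rbrakk> \<Longrightarrow> mul A a b \<in> carr A"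
    and add_assoc: "\<lbrakk>a \<in> carr A; b \<in> carr A; x \<in> carr A\<rbrakk>
      \<Longrightarrow> add A (add A a b) x = add A a (add A b x)"
    and add_commute: "\<lbrakk>a \<in> carr A; b \<in> carr A\<rbrakk> \<Longrightarrow> add A a b = add A b a"
    and add_zer: "a \<in> carr A \<Longrightarrow> add A a (zer A) = a"
    and add_inverse: "a \<in> carr A \<Longrightarrow> \<exists>b\<in>carr A. add A a b = zer A"
    and scal_add_right: "\<lbrakk>a \<in> carr A; b \<in> carr A\<rbrakk>
      \<Longrightarrow> scal A c (add A a b) = add A (scal A c a) (scal A c b)"
    and scal_add_left: "a \<in> carr A \<Longrightarrow> scal A (c + c') a = add A (scal A c a) (scal A c' a)"
    and scal_scal: "a \<in> carr A \<Longrightarrow> scal A c (scal A c' a) = scal A (c * c') a"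
    and scal_one: "a \<in> carr A \<Longrightarrow> scal A 1 a = a"
    and mul_assoc: "\<lbrakk>a \<in> carr A; b \<in> carr A; x \<in> carr A\<rbrakk>
      \<Longrightarrow> mul A (mul A a b) x = mul A a (mul A b x)"
    and mul_add_right: "\<lbrakk>a \<in> carr A; b \<in> carr A; x \<in> carr A\<rbrakk>
      \<Longrightarrow> mul A a (add A b x) = add A (mul A a b) (mul A a x)"
    and mul_add_left: "\<lbrakk>a \<in> carr A; b \<in> carr A; x \<in> carr A\<rbrakk>
      \<Longrightarrow> mul A (add A a b) x = add A (mul A a x) (mul A b x)"
    and mul_scal_left: "\<lbrakk>a \<in> carr A; b \<in> carr A\<rbrakk>
      \<Longrightarrow> mul A (scal A c a) b = scal A c (mul A a b)"
    and mul_scal_right: "\<lbrakk>a \<in> carr A; b \<in> carr A\<rbrakk>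
      \<Longrightarrow> mul A a (scal A c b) = scal A c (mul A a b)"
    and nrm_nonneg: "a \<in> carr A \<Longrightarrow> 0 \<le> nrm A a"
    and nrm_eq_0_iff: "a \<in> carr A \<Longrightarrow> nrm A a = 0 \<longleftrightarrow> a = zer A"
    and nrm_triangle: "\<lbrakk>a \<in> carr A; b \<in> carr A\<rbrakk> \<Longrightarrow> nrm A (add A a b) \<le> nrm A a + nrm A b"
    and nrm_scal: "a \<in> carr A \<Longrightarrow> nrm A (scal A c a) = cmod c * nrm A a"
    and nrm_mul: "\<lbrakk>a \<in> carr A; b \<in> carr A\<rbrakk> \<Longrightarrow> nrm A (mul A a b) \<le> nrm A a * nrm A b"
    and complete:
      "Metric_space.mcomplete (carr A) (\<lambda>a b. nrm A (add A a (scal A (- 1) b)))"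

definition isometric_isomorphism :: "'e normed_alg \<Rightarrow> 'f normed_alg \<Rightarrow> ('e \<Rightarrow> 'f) \<Rightarrow> bool" where
  "isometric_isomorphism A B h \<longleftrightarrow>
     bij_betw h (carr A) (carr B) \<and>
     (\<forall>a\<in>carr A. \<forall>b\<in>carr A. h (add A a b) = add B (h a) (h b)) \<and>
     (\<forall>c. \<forall>a\<in>carr A. h (scal A c a) = scal B c (h a)) \<and>
     (\<forall>a\<in>carr A. \<forall>b\<in>carr A. h (mul A a b) = mul B (h a) (h b)) \<and>
     (\<forall>a\<in>carr A. nrm B (h a) = nrm A a)"

text \<open>
  The quotient of \<open>op_alg\<close> by the closure of \<open>I\<close>, with cosets \<open>T +o closure I\<close> as elements.  The
  operations take unions over all representatives; for an ideal this is again a single coset, see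
  \<open>coset_ops\<close> below.
\<close>

definition quotient_alg :: "'n fock_op set \<Rightarrow> 'n fock_op set normed_alg" where
  "quotient_alg I =
     \<lparr> carr = (\<lambda>T. T +o closure I) ` op_alg,
       add = (\<lambda>K L. \<Union>S\<in>K. \<Union>T\<in>L. (S + T) +o closure I),
       zer = closure I,
       scal = (\<lambda>c K. \<Union>T\<in>K. op_scaleC c T +o closure I),
       mul = (\<lambda>K L. \<Union>S\<in>K. \<Union>T\<in>L. (S o\<^sub>L T) +o closure I),
       nrm = (\<lambda>K. INF T\<in>K. norm T) \<rparr>"

lemma coset_eq:
  assumes "ell2_op.subspace J" "S - T \<in> J"
  shows "S +o J = T +o J"
proof -
  have "S' +o J \<subseteq> T' +o J" if "S' - T' \<in> J" for S' T'
  proof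
    fix R assume "R \<in> S' +o J"
    then obtain b where b: "b \<in> J" "R = S' + b" by (auto simp: elt_set_plus_def)
    then have "R = T' + ((S' - T') + b)" by simp
    moreover have "(S' - T') + b \<in> J" using that b assms(1) ell2_op.subspace_add by blast
    ultimately show "R \<in> T' +o J" by (metis set_plus_intro2)
  qed
  moreover have "T - S \<in> J" using ell2_op.subspace_neg[OF assms] by simp
  ultimately show ?thesis using assms(2) by blast
qed

lemma subspace_closure_op:
  assumes "ell2_op.subspace I"
  shows "ell2_op.subspace (closure I)"
proof -
  have "closure I \<noteq> {}" using assms ell2_op.subspace_0 by fastforce
  have "op_scaleC c ` closure I \<subseteq> closure I" for c
  proof (rule image_closure_subset)
    show "continuous_on (closure I) (op_scaleC c)"
      unfolding op_scaleC_def by (intro continuous_intros)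
    show "op_scaleC c ` I \<subseteq> closure I"
      using assms ell2_op.subspace_scale closure_subset by blast
  qed simp
  moreover have "S + T \<in> closure I" if ST: "S \<in> closure I" "T \<in> closure I" for S T
  proof -
    obtain s t where "\<And>n. s n \<in> I" "s \<longlonglongrightarrow> S" "\<And>n. t n \<in> I" "t \<longlonglongrightarrow> T"
      using ST unfolding closure_sequential by blast
    then show ?thesis
      unfolding closure_sequential
      by (intro exI[of _ "\<lambda>n. s n + t n"]) (auto intro: tendsto_add assms ell2_op.subspace_add)
  qed
  moreover have "0 \<in> closure I" using assms ell2_op.subspace_0 closure_subset by blast
  ultimately show ?thesis unfolding ell2_op.subspace_def by blast
qed

lemma closure_ideal_mult:
  assumes I: "two_sided_ideal I" and S: "S \<in> op_alg" and T: "T \<in> closure I"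
  shows "S o\<^sub>L T \<in> closure I" "T o\<^sub>L S \<in> closure I"
proof -
  obtain s t where st: "\<And>n. s n \<in> poly_alg" "s \<longlonglongrightarrow> S" "\<And>n. t n \<in> I" "t \<longlonglongrightarrow> T"
    using S T unfolding op_alg_def closure_sequential by blast
  then have "(\<lambda>n. s n o\<^sub>L t n) \<longlonglongrightarrow> (S o\<^sub>L T)" "(\<lambda>n. t n o\<^sub>L s n) \<longlonglongrightarrow> (T o\<^sub>L S)"
    by (auto intro!: tendsto_intros bounded_bilinear.tendsto[OF bounded_bilinear_blinfun_compose])
  moreover have "s n o\<^sub>L t n \<in> I" "t n o\<^sub>L s n \<in> I" for n
    using I st unfolding two_sided_ideal_def by auto
  ultimately show "S o\<^sub>L T \<in> closure I" "T o\<^sub>L S \<in> closure I"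
    unfolding closure_sequential by (intro exI conjI; blast)+
qed

lemma op_alg_scaleC:
  assumes "T \<in> op_alg" shows "T (scaleC c f) = scaleC c (T f)"
proof -
  obtain t where t: "\<And>n. t n \<in> poly_alg" "t \<longlonglongrightarrow> T"
    using assms unfolding op_alg_def closure_sequential by blast
  have "(\<lambda>n. t n (scaleC c f)) \<longlonglongrightarrow> T (scaleC c f)"
    by (intro tendsto_intros t)
  moreover have "(\<lambda>n. t n (scaleC c f)) \<longlonglongrightarrow> scaleC c (T f)"
  proof -
    have "t n (scaleC c f) = scaleC c (t n f)" for n
      by (rule span_scaleC) (use t(1) poly_alg_eq_span in blast)
    then show ?thesis
      using bounded_linear.tendsto[OF bounded_linear_scaleC blinfun.tendsto[OF t(2) tendsto_const]]
      by simp
  qed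
  ultimately show ?thesis by (rule LIMSEQ_unique)
qed

lemma coset_ops:
  fixes I :: "'n fock_op set"
  defines "J \<equiv> closure I"
  assumes I: "two_sided_ideal I" and S: "S \<in> op_alg" and T: "T \<in> op_alg"
  shows "add (quotient_alg I) (S +o J) (T +o J) = (S + T) +o J"
    and "scal (quotient_alg I) c (T +o J) = op_scaleC c T +o J"
    and "mul (quotient_alg I) (S +o J) (T +o J) = (S o\<^sub>L T) +o J"
proof -
  have J: "ell2_op.subspace J"
    using I unfolding J_def two_sided_ideal_def by (blast intro: subspace_closure_op)
  have mem: "R \<in> R +o J" for R
    using ell2_op.subspace_0[OF J] by (auto simp: elt_set_plus_def)
  have const: "(\<Union>x\<in>B. f x) = K" if "B \<noteq> {}" "\<And>x. x \<in> B \<Longrightarrow> f x = K"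
    for B :: "'n fock_op set" and f and K :: "'n fock_op set" using that by auto
  have rep: "R' - R \<in> J" if "R' \<in> R +o J" for R R'
    using that by (auto simp: elt_set_plus_def)
  have JA: "J \<subseteq> op_alg"
    unfolding J_def op_alg_def
    by (rule closure_mono) (use I in \<open>simp add: two_sided_ideal_def\<close>)
  have A: "ell2_op.subspace (op_alg :: 'n fock_op set)"
    unfolding op_alg_def poly_alg_eq_span by (intro subspace_closure_op ell2_op.subspace_span)
  have repA: "R' \<in> op_alg" if "R' \<in> R +o J" "R \<in> op_alg" for R R'
    using that JA ell2_op.subspace_add[OF A] by (auto simp: elt_set_plus_def)
  have ne: "R +o J \<noteq> {}" for R using mem by blast
  show "add (quotient_alg I) (S +o J) (T +o J) = (S + T) +o J"
    unfolding quotient_alg_def J_def[symmetric] normed_alg.simps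
  proof (intro const ne coset_eq[OF J])
    fix S' T' assume *: "S' \<in> S +o J" "T' \<in> T +o J"
    have "S' + T' - (S + T) = (S' - S) + (T' - T)" by simp
    then show "S' + T' - (S + T) \<in> J"
      using rep[OF *(1)] rep[OF *(2)] ell2_op.subspace_add[OF J] by metis
  qed
  show "scal (quotient_alg I) c (T +o J) = op_scaleC c T +o J"
    unfolding quotient_alg_def J_def[symmetric] normed_alg.simps
  proof (intro const ne coset_eq[OF J])
    fix T' assume "T' \<in> T +o J"
    then have "op_scaleC c (T' - T) \<in> J" using rep ell2_op.subspace_scale[OF J] by blast
    then show "op_scaleC c T' - op_scaleC c T \<in> J" by (simp add: ell2_op.scale_right_diff_distrib)
  qed
  show "mul (quotient_alg I) (S +o J) (T +o J) = (S o\<^sub>L T) +o J"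
    unfolding quotient_alg_def J_def[symmetric] normed_alg.simps
  proof (intro const ne coset_eq[OF J])
    fix S' T' assume *: "S' \<in> S +o J" "T' \<in> T +o J"
    have "(S' o\<^sub>L T') - (S o\<^sub>L T) = ((S' - S) o\<^sub>L T') + (S o\<^sub>L (T' - T))"
      by (rule blinfun_eqI) (simp add: blinfun.add_left blinfun.diff_left blinfun.diff_right)
    moreover have "(S' - S) o\<^sub>L T' \<in> J" "S o\<^sub>L (T' - T) \<in> J"
      using closure_ideal_mult[OF I] rep[OF *(1)] rep[OF *(2)] repA[OF *(2) T] S
      unfolding J_def by auto
    ultimately show "(S' o\<^sub>L T') - (S o\<^sub>L T) \<in> J"
      using ell2_op.subspace_add[OF J] by metis
  qed
qed

locale banach_algebra_bundle =
  fixes E :: "'e topology" and X :: "'x topology" and \<pi> :: "'e \<Rightarrow> 'x"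
    and A :: "'x \<Rightarrow> 'e normed_alg"
  assumes proj_continuous: "continuous_map E X \<pi>"
    and proj_open: "open_map E X \<pi>"
    and proj_surj: "\<pi> ` topspace E = topspace X"
    and fiber_carr: "x \<in> topspace X \<Longrightarrow> carr (A x) = {e \<in> topspace E. \<pi> e = x}"
    and fiber_banach: "x \<in> topspace X \<Longrightarrow> banach_algebra (A x)"
    and A1: "continuous_map (subtopology (prod_topology E E) {(e1, e2). \<pi> e1 = \<pi> e2}) E
      (\<lambda>(e1, e2). add (A (\<pi> e1)) e1 e2)"
    and A2: "continuous_map (prod_topology E euclidean) E (\<lambda>(e, c). scal (A (\<pi> e)) c e)"
    and A3: "continuous_map (subtopology (prod_topology E E) {(e1, e2). \<pi> e1 = \<pi> e2}) E
      (\<lambda>(e1, e2). mul (A (\<pi> e1)) e1 e2)"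
    and A4_open: "\<lbrakk>x \<in> topspace X; openin X U; x \<in> U; \<epsilon> > 0\<rbrakk>
      \<Longrightarrow> openin E {e \<in> topspace E. \<pi> e \<in> U \<and> nrm (A (\<pi> e)) e < \<epsilon>}"
    and A4_base: "\<lbrakk>x \<in> topspace X; openin E V; zer (A x) \<in> V\<rbrakk>
      \<Longrightarrow> \<exists>U \<epsilon>. openin X U \<and> x \<in> U \<and> \<epsilon> > 0 \<and>
            {e \<in> topspace E. \<pi> e \<in> U \<and> nrm (A (\<pi> e)) e < \<epsilon>} \<subseteq> V"
    and A5: "continuous_map E euclideanreal (\<lambda>e. nrm (A (\<pi> e)) e)"

end

theory Submission
  imports Defs
begin

text \<open>
  The norm on the fibers sees the projections.  A homogeneous polynomial \<open>T\<close> of degree \<open>k\<close> is a linear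
  combination of isometries with pairwise orthogonal ranges, so its operator norm is the norm of the
  vector \<open>Ev T\<close> (\<open>norm_poly_homog\<close>).  Since the ideal \<open>I\<close> is graded, approximating \<open>T\<close> by
  elements of \<open>I\<close> is best done inside degree \<open>k\<close>, and there it amounts to approximating the vector
  \<open>Ev T\<close> by vectors of \<open>Ev ` I\<close>.  Hence the quotient norm of \<open>T\<close> is the norm of \<open>p\<^sub>I (Ev T)\<close>
  (\<open>quotient_norm_homogeneous\<close>).

  In the bundle, the sections of all homogeneous polynomials of degree \<open>k \<ge> 1\<close> are continuous, because
  addition, scaling and multiplication are, and because they are built from the creation operators.  As the norm of
  the bundle is continuous, the norm of \<open>p\<^bsub>I x\<^esub> f\<close> depends continuously on \<open>x\<close>, for each homogeneous
  vector \<open>f\<close> of degree \<open>k\<close>.  Degree 0 has to be treated apart, since the unit section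
  need not be continuous a priori; but a graded ideal has no component of degree 0, so
  there \<open>p\<^bsub>I x\<^esub> f = f\<close> (\<open>norm_ideal_proj_continuous\<close>).

  Finally, each \<open>p\<^sub>I\<close> preserves the degree, so polarization turns continuity of the norms into continuity of
  \<open>p\<^bsub>I x\<^esub> f\<close> itself (\<open>tendsto_orth_proj\<close>).  Homogeneous vectors span a dense subspace and projections
  are contractions, which extends this to all vectors (\<open>tendsto_contractions_of_kets\<close>), and pointwise
  continuity is continuity for the strong operator topology.
\<close>

section \<open>Convergence of orthogonal projections\<close>

lemma orth_proj_inner:
  assumes "is_orth_proj p S" "h \<in> S"
  shows "inner h (p f) = inner h f"
proof -
  have "cinner h (f - p f) = 0"
    using assms by (auto simp: is_orth_proj_def orth_complement_def)
  then have "inner h (f - p f) = 0" by (rule inner_eq_0_if_cinner)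
  then show ?thesis by (simp add: inner_diff_right)
qed

lemma norm_orth_proj_le:
  assumes "is_orth_proj p S"
  shows "norm (p f) \<le> norm f"
proof -
  have "p f \<in> S" using assms by (simp add: is_orth_proj_def)
  then have "(norm (p f))\<^sup>2 = inner (p f) f"
    using orth_proj_inner[OF assms] by (simp add: power2_norm_eq_inner)
  also have "\<dots> \<le> norm (p f) * norm f" by (rule norm_cauchy_schwarz)
  finally have "norm (p f) * norm (p f) \<le> norm (p f) * norm f" by (simp add: power2_eq_square)
  then show ?thesis by (cases "p f = 0") auto
qed

lemma orth_proj_eqI:
  assumes p: "is_orth_proj p S" and S: "ell2.subspace S"
    and g: "g \<in> S" and h: "\<And>s. s \<in> S \<Longrightarrow> inner s (f - g) = 0"
  shows "p f = g"
proof -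
  have pg: "p f - g \<in> S"
    using p g S by (simp add: is_orth_proj_def ell2.subspace_diff)
  have "inner (p f - g) (p f) = inner (p f - g) f" by (rule orth_proj_inner[OF p pg])
  with h[OF pg] have "inner (p f - g) (p f - g) = 0" by (simp add: inner_diff_right)
  then show ?thesis by simp
qed

text \<open>
  For an orthogonal projection \<open>q\<close>, the number \<open>inner (q f) g = inner (q f) (q g)\<close> is a combination of
  two squared norms of values of \<open>q\<close>.  Convergence of norms on a subspace \<open>H\<close> therefore gives
  convergence of \<open>inner (P x f) g\<close> for \<open>f\<close> and \<open>g\<close> in \<open>H\<close>.  With \<open>g = p f\<close>, which is why \<open>p f\<close>
  has to lie in \<open>H\<close>, expanding the square of the norm of \<open>P x f - g\<close> finishes the proof.
\<close>

lemma tendsto_orth_proj: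
  fixes P :: "'x \<Rightarrow> 'a ell2 \<Rightarrow>\<^sub>L 'a ell2"
  assumes P: "\<And>x. is_orth_proj (P x) (S x)" and p: "is_orth_proj p S0"
    and lim: "\<And>g. g \<in> H \<Longrightarrow> ((\<lambda>x. norm (P x g)) \<longlongrightarrow> norm (p g)) F"
    and H: "ell2.subspace H" and f: "f \<in> H" and pf: "p f \<in> H"
  shows "((\<lambda>x. P x f) \<longlongrightarrow> p f) F"
proof -
  define g where "g = p f"
  have range: "P x h \<in> S x" "p h \<in> S0" for x h
    using P p by (auto simp: is_orth_proj_def)
  have sq: "(norm (q (f + g)))\<^sup>2 - (norm (q (f - g)))\<^sup>2 = 4 * inner (q f) (q g)"
    for q :: "'a ell2 \<Rightarrow>\<^sub>L 'a ell2"
    by (simp add: blinfun.add_right blinfun.diff_right power2_norm_eq_inner inner_add_left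
        inner_add_right inner_diff_left inner_diff_right inner_commute)
  have polar: "inner (P x f) g = ((norm (P x (f + g)))\<^sup>2 - (norm (P x (f - g)))\<^sup>2) / 4" for x
    using orth_proj_inner[OF P range(1), of x f g] sq[of "P x"] by simp
  have polar0: "inner (p f) g = ((norm (p (f + g)))\<^sup>2 - (norm (p (f - g)))\<^sup>2) / 4"
    using orth_proj_inner[OF p range(2), of f g] sq[of p] by simp
  have H': "f + g \<in> H" "f - g \<in> H"
    using f pf H by (auto simp: g_def ell2.subspace_add ell2.subspace_diff)
  have "((\<lambda>x. inner (P x f) g) \<longlongrightarrow> inner (p f) g) F"
    unfolding polar polar0
    using tendsto_diff[OF tendsto_power[OF lim[OF H'(1)], of 2] tendsto_power[OF lim[OF H'(2)], of 2]]
    by (rule tendsto_divide) auto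
  then have "((\<lambda>x. (norm (P x f))\<^sup>2 - 2 * inner (P x f) g + (norm g)\<^sup>2)
      \<longlongrightarrow> (norm (p f))\<^sup>2 - 2 * inner (p f) g + (norm g)\<^sup>2) F"
    by (intro tendsto_add tendsto_diff tendsto_mult tendsto_power tendsto_const lim[OF f])
  moreover have "(norm (P x f - g))\<^sup>2 = (norm (P x f))\<^sup>2 - 2 * inner (P x f) g + (norm g)\<^sup>2" for x
    by (simp add: power2_norm_eq_inner inner_diff_left inner_diff_right inner_commute)
  ultimately have "((\<lambda>x. (norm (P x f - g))\<^sup>2) \<longlongrightarrow> 0) F"
    by (simp add: g_def power2_norm_eq_inner)
  from tendsto_real_sqrt[OF this] have "((\<lambda>x. norm (P x f - g)) \<longlongrightarrow> 0) F"
    by simp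
  from LIM_zero_cancel[OF tendsto_norm_zero_cancel[OF this]] show ?thesis
    by (simp only: g_def)
qed

text \<open>
  The vectors at which the operators converge form a closed subspace, by uniform boundedness.  A
  vector orthogonal to all complex multiples of the basis vectors is zero, so this subspace is everything.
\<close>

lemma tendsto_contractions_of_kets:
  fixes P :: "'x \<Rightarrow> 'a ell2 \<Rightarrow>\<^sub>L 'a ell2" and p :: "'a ell2 \<Rightarrow>\<^sub>L 'a ell2"
  assumes P: "\<And>x f. norm (P x f) \<le> norm f" and p: "\<And>f. norm (p f) \<le> norm f"
    and ket: "\<And>c w. ((\<lambda>x. P x (scaleC c (ket w))) \<longlongrightarrow> p (scaleC c (ket w))) F"
  shows "((\<lambda>x. P x f) \<longlongrightarrow> p f) F"
proof -
  define C where "C = {f. ((\<lambda>x. P x f) \<longlongrightarrow> p f) F}"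
  have sub: "subspace C"
    unfolding subspace_def C_def
    by (auto simp: blinfun.add_right blinfun.scaleR_right blinfun.zero_right intro!: tendsto_intros)
  have "f \<in> C" if f: "f \<in> closure C" for f
    unfolding C_def mem_Collect_eq tendsto_iff
  proof (intro allI impI)
    fix e :: real assume e: "e > 0"
    then have e3: "e / 3 > 0" by simp
    then obtain g where g: "g \<in> C" "dist g f < e / 3"
      using f unfolding closure_approachable by blast
    have ev: "eventually (\<lambda>x. dist (P x g) (p g) < e / 3) F"
      using g(1) e3 unfolding C_def tendsto_iff by blast
    have fg: "norm (f - g) < e / 3" using g(2) by (simp add: dist_norm norm_minus_commute)
    show "eventually (\<lambda>x. dist (P x f) (p f) < e) F"
      using ev
    proof eventually_elim
      case (elim x)
      have "P x f - p f = P x (f - g) + (P x g - p g) - p (f - g)"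
        by (simp add: blinfun.diff_right)
      then have "norm (P x f - p f) \<le> norm (P x (f - g)) + norm (P x g - p g) + norm (p (f - g))"
        using norm_triangle_ineq4[of "P x (f - g) + (P x g - p g)" "p (f - g)"]
          norm_triangle_ineq[of "P x (f - g)" "P x g - p g"] by simp
      then show ?case
        using elim fg P[of x "f - g"] p[of "f - g"] by (simp add: dist_norm)
    qed
  qed
  then have "closed C" using closure_subset_eq by blast
  \<comment> \<open>Density: what the projection onto \<open>C\<close> leaves over has all its coordinates equal to 0.\<close>
  from hilbert_projection[OF sub this]
  obtain g where g: "g \<in> C" "\<And>h. h \<in> C \<Longrightarrow> inner h (f - g) = 0" by blast
  have "ell2_apply (f - g) w = 0" for w
    unfolding cinner_ket[symmetric]
    by (rule cinner_eq_0_if_inner) (use g(2) ket in \<open>auto simp: C_def\<close>)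
  then have "f = g"
    by (intro ell2_eqI) (simp add: minus_ell2.rep_eq)
  with g(1) show ?thesis by (simp add: C_def)
qed


section \<open>Homogeneous vectors and homogeneous polynomials\<close>

definition fock_homog :: "nat \<Rightarrow> 'n fock set" where
  "fock_homog k = {f. \<forall>w. length w \<noteq> k \<longrightarrow> ell2_apply f w = 0}"

lemma subspace_fock_homog: "ell2.subspace (fock_homog k)"
  by (auto simp: ell2.subspace_def fock_homog_def zero_ell2.rep_eq plus_ell2.rep_eq scaleC.rep_eq)

lemma continuous_ell2_apply: "continuous_on UNIV (\<lambda>f. ell2_apply f w)"
proof -
  have "bounded_linear (\<lambda>f. ell2_apply f w)"
    by (rule bounded_linear_intro[where K = 1])
       (auto simp: plus_ell2.rep_eq scaleR_ell2.rep_eq scaleR_conv_of_real cmod_ell2_apply_le)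
  then show ?thesis by (rule linear_continuous_on)
qed

lemma closed_fock_homog: "closed (fock_homog k)"
proof -
  have "closed {f. length w \<noteq> k \<longrightarrow> ell2_apply f w = 0}" for w :: "'n list"
    by (cases "length w = k") (auto intro!: closed_Collect_eq continuous_ell2_apply)
  then show ?thesis unfolding fock_homog_def by (rule closed_Collect_all)
qed

lemma ket_in_fock_homog: "ket w \<in> fock_homog (length w)"
  by (auto simp: fock_homog_def ket.rep_eq)

lemma cinner_fock_homog:
  assumes "f \<in> fock_homog j" "g \<in> fock_homog k" "j \<noteq> k"
  shows "cinner f g = 0"
proof -
  have "(\<lambda>w. cnj (ell2_apply f w) * ell2_apply g w) = (\<lambda>_. 0)"
  proof
    fix w show "cnj (ell2_apply f w) * ell2_apply g w = 0"
      using assms by (cases "length w = j") (auto simp: fock_homog_def)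
  qed
  then show ?thesis unfolding cinner_def by simp
qed

lemma finite_words: "finite {w :: ('n :: finite) list. length w = k}"
  using finite_lists_length_eq[of "UNIV :: 'n set" k] by simp

lemma ell2_apply_sum: "ell2_apply (sum f B) w = (\<Sum>b\<in>B. ell2_apply (f b) w)"
  by (induction B rule: infinite_finite_induct) (auto simp: zero_ell2.rep_eq plus_ell2.rep_eq)

lemma fock_homog_expansion:
  fixes f :: "('n :: finite) fock"
  assumes "f \<in> fock_homog k"
  shows "f = (\<Sum>w | length w = k. scaleC (ell2_apply f w) (ket w))"
proof (rule ell2_eqI)
  fix v
  show "ell2_apply f v = ell2_apply (\<Sum>w | length w = k. scaleC (ell2_apply f w) (ket w)) v"
    using assms
    by (auto simp: ell2_apply_sum scaleC.rep_eq ket.rep_eq fock_homog_def finite_words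
        if_distrib[where f = "\<lambda>t. _ * t"] cong: if_cong)
qed

lemma Ev_add: "Ev (S + T) = Ev S + Ev T"
  and Ev_diff: "Ev (S - T) = Ev S - Ev T"
  and Ev_scaleC: "Ev (op_scaleC c T) = scaleC c (Ev T)"
  by (simp_all add: Ev_def blinfun.add_left blinfun.diff_left)

lemma subspace_poly_homog: "ell2_op.subspace (poly_homog k)"
  unfolding poly_homog_def by (rule ell2_op.subspace_span)

lemma poly_homog_subset: "poly_homog k \<subseteq> poly_alg"
  unfolding poly_homog_def poly_alg_eq_span by (intro ell2_op.span_mono) auto

lemma Ev_in_fock_homog:
  assumes "T \<in> poly_homog k"
  shows "Ev T \<in> fock_homog k"
  using assms unfolding poly_homog_def
proof (induction rule: ell2_op.span_induct_alt)
  case base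
  show ?case using ell2.subspace_0[OF subspace_fock_homog] by (simp add: Ev_def)
next
  case (step c S T)
  then obtain w where "S = word_op w" "length w = k" by auto
  then have "Ev S \<in> fock_homog k" using ket_in_fock_homog[of w] by (simp add: Ev_word_op)
  then show ?case
    using step unfolding Ev_add Ev_scaleC
    by (intro ell2.subspace_add[OF subspace_fock_homog] ell2.subspace_scale[OF subspace_fock_homog])
qed

lemma fock_homog_eq_Ev: "fock_homog k = Ev ` (poly_homog k :: ('n :: finite) fock_op set)"
proof (intro equalityI subsetI)
  fix f :: "'n fock" assume f: "f \<in> fock_homog k"
  let ?T = "\<Sum>w | length w = k. op_scaleC (ell2_apply f w) (word_op w)"
  have "?T \<in> poly_homog k"
    unfolding poly_homog_def
    by (intro ell2_op.span_sum ell2_op.span_scale ell2_op.span_base) auto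
  moreover have "Ev ?T = (\<Sum>w | length w = k. scaleC (ell2_apply f w) (ket w))"
    by (simp add: Ev_def blinfun.sum_left) (simp flip: Ev_def add: Ev_word_op)
  ultimately show "f \<in> Ev ` poly_homog k" using fock_homog_expansion[OF f] by (intro image_eqI) auto
qed (auto simp: Ev_in_fock_homog)

lemma norm_word_op: "norm (word_op w f) = norm f"
  by (induction w) (auto simp: norm_creation)

lemma inner_creation: "inner (creation i f) (creation j g) = (if i = j then inner f g else 0)"
proof (cases "i = j")
  case True
  have "4 * inner (creation i f) (creation i g)
      = (norm (creation i (f + g)))\<^sup>2 - (norm (creation i (f - g)))\<^sup>2"
    by (simp add: blinfun.add_right blinfun.diff_right power2_norm_eq_inner inner_add_left
        inner_add_right inner_diff_left inner_diff_right inner_commute)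
  also have "\<dots> = 4 * inner f g"
    unfolding norm_creation
    by (simp add: power2_norm_eq_inner inner_add_left
        inner_add_right inner_diff_left inner_diff_right inner_commute)
  finally show ?thesis using True by simp
next
  case False
  then have "(\<lambda>w. cnj (ell2_apply (creation i f) w) * ell2_apply (creation j g) w) = (\<lambda>_. 0)"
    by (auto simp: fun_eq_iff creation.rep_eq creation_fun.rep_eq split: list.splits)
  then have "cinner (creation i f) (creation j g) = 0" unfolding cinner_def by simp
  with False show ?thesis by (simp add: inner_eq_0_if_cinner)
qed

lemma inner_word_op:
  assumes "length v = length w" "v \<noteq> w"
  shows "inner (word_op v f) (word_op w g) = 0"
  using assms by (induction v w rule: list_induct2) (auto simp: inner_creation)

lemma norm_ket: "norm (ket w) = 1"
  by (simp add: norm_eq_sqrt_inner inner_ell2_def cinner_ket ket.rep_eq)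

lemma norm_Ev_le: "norm (Ev T) \<le> norm T"
  unfolding Ev_def using norm_blinfun[of T "ket []"] by (simp add: norm_ket)

text \<open>
  Monomials of the same degree are isometries with pairwise orthogonal ranges.  By Pythagoras,
  \<open>T\<close> multiplies the norm of every vector by one and the same factor, which is found by applying \<open>T\<close> to the
  vacuum vector \<open>ket []\<close>.
\<close>

lemma norm_poly_homog:
  fixes T :: "('n :: finite) fock_op"
  assumes "T \<in> poly_homog k"
  shows "norm T = norm (Ev T)"
proof (rule antisym)
  have "\<exists>a. T = (\<Sum>w | length w = k. op_scaleC (a w) (word_op w))"
    using assms unfolding poly_homog_def
  proof (induction rule: ell2_op.span_induct_alt)
    case base
    show ?case by (intro exI[of _ "\<lambda>_. 0"]) simp
  next
    case (step c S T)
    then obtain v a where v: "S = word_op v" "length v = k"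
      and a: "T = (\<Sum>w | length w = k. op_scaleC (a w) (word_op w))" by auto
    have "op_scaleC c S = (\<Sum>w | length w = k. op_scaleC (if w = v then c else 0) (word_op w))"
      using v finite_words[of k]
      by (subst sum.mono_neutral_right[of _ "{v}"]) auto
    then show ?case
      unfolding a
      by (intro exI[of _ "\<lambda>w. (if w = v then c else 0) + a w"])
         (simp add: ell2_op.scale_left_distrib sum.distrib)
  qed
  then obtain a where a: "T = (\<Sum>w | length w = k. op_scaleC (a w) (word_op w))" by blast
  have sq: "(norm (T f))\<^sup>2 = (\<Sum>w | length w = k. (cmod (a w))\<^sup>2) * (norm f)\<^sup>2" for f
  proof -
    have "(norm (T f))\<^sup>2 = (norm (\<Sum>w | length w = k. word_op w (scaleC (a w) f)))\<^sup>2"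
      by (simp add: a blinfun.sum_left word_op_scaleC)
    also have "\<dots> = (\<Sum>w | length w = k. (norm (word_op w (scaleC (a w) f)))\<^sup>2)"
      by (intro norm_sum_Pythagorean finite_words)
         (auto simp: pairwise_def orthogonal_def inner_word_op)
    finally show ?thesis
      by (simp add: norm_word_op norm_scaleC power_mult_distrib sum_distrib_right)
  qed
  show "norm T \<le> norm (Ev T)"
  proof (rule norm_blinfun_bound)
    fix f
    have "(norm (T f))\<^sup>2 = (norm (Ev T) * norm f)\<^sup>2"
      using sq[of f] sq[of "ket []"] by (simp add: Ev_def norm_ket power_mult_distrib)
    then show "norm (T f) \<le> norm (Ev T) * norm f" by simp
  qed simp
  show "norm (Ev T) \<le> norm T" by (rule norm_Ev_le)
qed


section \<open>The quotient norm of a homogeneous polynomial\<close>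

lemma ideal_proj_Ev_ideal:
  assumes "q \<in> closure (Ev ` I)"
  shows "ideal_proj I q = 0"
proof (rule orth_proj_eqI[OF is_orth_proj_ideal_proj subspace_orth_complement])
  show "0 \<in> orth_complement (Ev ` I)"
    using subspace_orth_complement by (rule ell2.subspace_0)
  fix s :: "'a fock" assume s: "s \<in> orth_complement (Ev ` I)"
  have "closure (Ev ` I) \<subseteq> {h. inner s h = 0}"
  proof (rule closure_minimal)
    show "Ev ` I \<subseteq> {h. inner s h = 0}"
      using s by (auto simp: orth_complement_def inner_commute[of s] intro: inner_eq_0_if_cinner)
    show "closed {h. inner s h = 0}" by (intro closed_Collect_eq continuous_intros)
  qed
  then show "inner s (q - 0) = 0" using assms by auto
qed

lemma subspace_closure:
  fixes V :: "'a :: real_normed_vector set"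
  assumes "subspace V"
  shows "subspace (closure V)"
  unfolding subspace_def
proof (intro conjI ballI allI)
  show "0 \<in> closure V" using subspace_0[OF assms] closure_subset by blast
  fix v w assume *: "v \<in> closure V" "w \<in> closure V"
  have "V + V \<subseteq> V" using subspace_add[OF assms] by (auto simp: set_plus_def)
  then have "closure (V + V) \<subseteq> closure V" by (rule closure_mono)
  then show "v + w \<in> closure V" using * closure_sum[of V V] by blast
next
  fix c v assume "v \<in> closure V"
  moreover have "(*\<^sub>R) c ` V \<subseteq> V" using subspace_scale[OF assms] by auto
  ultimately show "c *\<^sub>R v \<in> closure V"
    using closure_scaleR[of c V] closure_mono by blast
qed

text \<open>
  The closure of the image under \<open>Ev\<close> of the degree \<open>k\<close> part of the ideal consists of vectors of degree \<open>k\<close>.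
  Subtracting from \<open>f\<close> its projection to that closure leaves a vector that is orthogonal to \<open>Ev\<close> of the degree
  \<open>k\<close> part by construction and to \<open>Ev\<close> of the other parts because the degrees differ; so what is left is
  \<open>ideal_proj I f\<close>.
\<close>

lemma ideal_proj_homogeneous:
  fixes I :: "('n :: finite) fock_op set"
  assumes I: "graded_ideal I" and f: "f \<in> fock_homog k"
  shows "ideal_proj I f \<in> fock_homog k"
    and "f - ideal_proj I f \<in> closure (Ev ` (I \<inter> poly_homog k))"
    and "k = 0 \<Longrightarrow> ideal_proj I f = f"
proof -
  obtain J where J: "\<And>j. j \<ge> 1 \<Longrightarrow> ell2_op.subspace (J j)" "\<And>j. j \<ge> 1 \<Longrightarrow> J j \<subseteq> poly_homog j"
    and I_eq: "I = ell2_op.span (\<Union>j\<in>{1..}. J j)"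
    using I unfolding graded_ideal_def by blast
  \<comment> \<open>The degree \<open>k\<close> part of \<open>I\<close>: the sum defining \<open>I\<close> starts at degree 1, so for \<open>k = 0\<close> it is \<open>{0}\<close>.\<close>
  define K where "K = (if k = 0 then {0} else J k)"
  have K: "ell2_op.subspace K" "K \<subseteq> poly_homog k"
    using J(1)[of k] J(2)[of k] ell2_op.subspace_0[OF subspace_poly_homog]
    by (auto simp: K_def ell2_op.subspace_single_0)
  have KI: "K \<subseteq> I"
  proof (cases "k = 0")
    case True
    then show ?thesis by (simp add: K_def I_eq ell2_op.span_zero)
  next
    case False
    then have "K \<subseteq> (\<Union>j\<in>{1..}. J j)" by (auto simp: K_def intro!: bexI[of _ k])
    then show ?thesis unfolding I_eq using ell2_op.span_superset by blast
  qed
  let ?V = "closure (Ev ` K)"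
  have EvK: "Ev (op_scaleC c S) \<in> Ev ` K" if "S \<in> K" for c S
    using that ell2_op.subspace_scale[OF K(1)] by blast
  have sub: "subspace ?V"
  proof (rule subspace_closure)
    have "ell2.subspace (Ev ` K)"
      using module_hom.subspace_image[OF Ev_linear[unfolded linear_iff_module_hom] K(1)] .
    then show "subspace (Ev ` K)" by (auto simp: subspace_def ell2.subspace_def scaleR_scaleC)
  qed
  obtain g where g: "g \<in> ?V" and orth: "\<And>h. h \<in> ?V \<Longrightarrow> inner h (f - g) = 0"
    using hilbert_projection[OF sub closed_closure, of f] by blast
  have "Ev ` K \<subseteq> fock_homog k" using K(2) Ev_in_fock_homog by blast
  then have "g \<in> fock_homog k"
    using g closure_minimal[OF _ closed_fock_homog] by blast
  then have fg: "f - g \<in> fock_homog k"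
    using f ell2.subspace_diff[OF subspace_fock_homog] by blast
  have gI: "g \<in> closure (Ev ` I)" using g closure_mono[of "Ev ` K" "Ev ` I"] KI by blast
  have gen: "cinner (Ev S) (f - g) = 0" if S: "S \<in> J j" "j \<ge> 1" for S j
  proof (cases "j = k")
    case True
    then have "S \<in> K" using S by (simp add: K_def)
    have "scaleC c (Ev S) \<in> ?V" for c
      using EvK[OF \<open>S \<in> K\<close>, of c] subsetD[OF closure_subset] by (metis Ev_scaleC)
    then show ?thesis by (intro cinner_eq_0_if_inner orth)
  next
    case False
    then show ?thesis using cinner_fock_homog[OF Ev_in_fock_homog fg] S J(2) by blast
  qed
  have "cinner (f - g) (Ev S) = 0" if "S \<in> I" for S
    using that unfolding I_eq
  proof (induction rule: ell2_op.span_induct_alt)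
    case base
    show ?case by (simp add: Ev_def)
  next
    case (step c S T)
    then have "cinner (Ev S) (f - g) = 0" using gen by auto
    then have "cinner (f - g) (Ev S) = 0" using cinner_commute[of "f - g" "Ev S"] by simp
    with step show ?case by (simp add: Ev_add Ev_scaleC cinner_add_right cinner_scaleC_right)
  qed
  then have fgM: "f - g \<in> orth_complement (Ev ` I)"
    unfolding orth_complement_def using cinner_commute[of _ "f - g"] by auto
  have pf: "ideal_proj I f = f - g"
  proof (rule orth_proj_eqI[OF is_orth_proj_ideal_proj subspace_orth_complement fgM])
    fix s assume "s \<in> orth_complement (Ev ` I)"
    then have "inner s g = inner s (ideal_proj I g)"
      by (rule orth_proj_inner[OF is_orth_proj_ideal_proj, symmetric])
    then show "inner s (f - (f - g)) = 0" by (simp add: ideal_proj_Ev_ideal[OF gI])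
  qed
  show "ideal_proj I f \<in> fock_homog k" unfolding pf by (rule fg)
  have "Ev ` K \<subseteq> Ev ` (I \<inter> poly_homog k)" using K(2) KI by blast
  then have "?V \<subseteq> closure (Ev ` (I \<inter> poly_homog k))" by (rule closure_mono)
  then show "f - ideal_proj I f \<in> closure (Ev ` (I \<inter> poly_homog k))"
    using g unfolding pf by auto
  show "ideal_proj I f = f" if "k = 0"
    using g unfolding pf by (simp add: that K_def Ev_def)
qed

text \<open>
  Lower bound: \<open>Ev\<close> and the projection do not increase norms, and the projection annihilates the
  image of the closed ideal.  Upper bound: subtracting elements of the ideal of the same degree
  keeps \<open>T\<close> homogeneous, so the operator norm of the difference is the norm of a vector of degree \<open>k\<close>, and by
  \<open>ideal_proj_homogeneous\<close> such vectors come arbitrarily close to \<open>ideal_proj I (Ev T)\<close>.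
\<close>

lemma quotient_norm_homogeneous:
  fixes I :: "('n :: finite) fock_op set"
  assumes I: "graded_ideal I" and T: "T \<in> poly_homog k"
  shows "nrm (quotient_alg I) (T +o closure I) = norm (ideal_proj I (Ev T))"
proof -
  let ?N = "INF R \<in> T +o closure I. norm R" and ?p = "ideal_proj I"
  have subI: "ell2_op.subspace (closure I)"
    using I unfolding graded_ideal_def two_sided_ideal_def by (blast intro: subspace_closure_op)
  have bdd: "bdd_below (norm ` (T +o closure I))" by (rule bdd_belowI2[of _ 0]) simp
  have "?N \<le> norm (?p (Ev T))"
  proof -
    \<comment> \<open>The bound holds for \<open>q\<close> in the image of the ideal, hence for \<open>q = Ev T - ideal_proj I (Ev T)\<close> in its closure.\<close>
    have "Ev ` (I \<inter> poly_homog k) \<subseteq> {q. ?N \<le> norm (Ev T - q)}"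
    proof clarify
      fix S assume S: "S \<in> I" "S \<in> poly_homog k"
      have "- S \<in> closure I"
        using S(1) closure_subset ell2_op.subspace_neg[OF subI] by blast
      then have "T - S \<in> T +o closure I" by (metis diff_conv_add_uminus set_plus_intro2)
      then have "?N \<le> norm (T - S)" by (rule cINF_lower[OF bdd])
      also have "\<dots> = norm (Ev T - Ev S)"
        using norm_poly_homog[OF ell2_op.subspace_diff[OF subspace_poly_homog T S(2)]]
        by (simp add: Ev_diff)
      finally show "?N \<le> norm (Ev T - Ev S)" .
    qed
    then have "closure (Ev ` (I \<inter> poly_homog k)) \<subseteq> {q. ?N \<le> norm (Ev T - q)}"
      by (rule closure_minimal) (intro closed_Collect_le continuous_intros)
    then show ?thesis using ideal_proj_homogeneous(2)[OF I Ev_in_fock_homog[OF T]] by auto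
  qed
  moreover have "norm (?p (Ev T)) \<le> ?N"
  proof (rule cINF_greatest)
    show "T +o closure I \<noteq> {}"
      using ell2_op.subspace_0[OF subI] by (auto simp: elt_set_plus_def)
    fix R assume "R \<in> T +o closure I"
    then obtain S where S: "S \<in> closure I" "R = T + S" by (auto simp: elt_set_plus_def)
    have "Ev ` closure I \<subseteq> closure (Ev ` I)"
      unfolding Ev_def by (intro image_closure_subset continuous_intros closure_subset) auto
    then have "?p (Ev S) = 0" using S(1) by (auto intro: ideal_proj_Ev_ideal)
    then have "?p (Ev T) = ?p (Ev R)" by (simp add: S Ev_add blinfun.add_right)
    also have "norm \<dots> \<le> norm (Ev R)" by (rule norm_orth_proj_le[OF is_orth_proj_ideal_proj])
    also have "\<dots> \<le> norm R" by (rule norm_Ev_le)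
    finally show "norm (?p (Ev T)) \<le> norm R" .
  qed
  ultimately show ?thesis by (simp add: quotient_alg_def)
qed


section \<open>Continuous sections\<close>

locale quotient_bundle = banach_algebra_bundle E X \<pi> A
  for E :: "'e topology" and X :: "'x topology" and \<pi> :: "'e \<Rightarrow> 'x"
    and A :: "'x \<Rightarrow> 'e normed_alg" +
  fixes I :: "'x \<Rightarrow> ('n :: finite) fock_op set"
    and \<theta> :: "'x \<Rightarrow> 'n fock_op set \<Rightarrow> 'e"
  assumes graded: "x \<in> topspace X \<Longrightarrow> graded_ideal (I x)"
    and iso: "x \<in> topspace X \<Longrightarrow> isometric_isomorphism (quotient_alg (I x)) (A x) (\<theta> x)"
    and creation_continuous: "continuous_map X E (\<lambda>x. \<theta> x (creation i +o closure (I x)))"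
begin

definition sec :: "'n fock_op \<Rightarrow> 'x \<Rightarrow> 'e" where
  "sec T x = \<theta> x (T +o closure (I x))"

lemma coset_in_carr: "T \<in> op_alg \<Longrightarrow> T +o closure (I x) \<in> carr (quotient_alg (I x))"
  by (simp add: quotient_alg_def)

lemma sec_in_carr:
  assumes "x \<in> topspace X" "T \<in> op_alg"
  shows "sec T x \<in> carr (A x)"
  using iso[OF assms(1)] coset_in_carr[OF assms(2)]
  unfolding sec_def isometric_isomorphism_def by (meson bij_betwE)

lemma proj_sec:
  assumes "x \<in> topspace X" "T \<in> op_alg"
  shows "\<pi> (sec T x) = x"
  using sec_in_carr[OF assms] fiber_carr[OF assms(1)] by simp

lemma
  assumes x: "x \<in> topspace X" and S: "S \<in> op_alg" and T: "T \<in> op_alg"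
  shows sec_add: "sec (S + T) x = add (A x) (sec S x) (sec T x)"
    and sec_scaleC: "sec (op_scaleC c T) x = scal (A x) c (sec T x)"
    and sec_mult: "sec (S o\<^sub>L T) x = mul (A x) (sec S x) (sec T x)"
proof -
  have "two_sided_ideal (I x)" using graded[OF x] by (simp add: graded_ideal_def)
  note ops = coset_ops[OF this S T] and * = coset_in_carr[OF S] coset_in_carr[OF T]
  show "sec (S + T) x = add (A x) (sec S x) (sec T x)"
    "sec (op_scaleC c T) x = scal (A x) c (sec T x)"
    "sec (S o\<^sub>L T) x = mul (A x) (sec S x) (sec T x)"
    using iso[OF x] * unfolding sec_def ops[symmetric] isometric_isomorphism_def by simp_all
qed

lemma sec_pair_continuous:
  assumes S: "S \<in> op_alg" "continuous_map X E (sec S)"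
    and T: "T \<in> op_alg" "continuous_map X E (sec T)"
  shows "continuous_map X (subtopology (prod_topology E E) {(e1, e2). \<pi> e1 = \<pi> e2})
    (\<lambda>x. (sec S x, sec T x))"
  unfolding continuous_map_in_subtopology
  using S T by (auto simp: proj_sec intro: continuous_map_pairedI)

lemma sec_add_continuous:
  assumes "S \<in> op_alg" "continuous_map X E (sec S)"
    and "T \<in> op_alg" "continuous_map X E (sec T)"
  shows "continuous_map X E (sec (S + T))"
  using continuous_map_compose[OF sec_pair_continuous[OF assms] A1]
  by (rule continuous_map_eq) (simp add: proj_sec sec_add assms)

lemma sec_mult_continuous:
  assumes "S \<in> op_alg" "continuous_map X E (sec S)"
    and "T \<in> op_alg" "continuous_map X E (sec T)"
  shows "continuous_map X E (sec (S o\<^sub>L T))"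
  using continuous_map_compose[OF sec_pair_continuous[OF assms] A3]
  by (rule continuous_map_eq) (simp add: proj_sec sec_mult assms)

lemma sec_scaleC_continuous:
  assumes "T \<in> op_alg" "continuous_map X E (sec T)"
  shows "continuous_map X E (sec (op_scaleC c T))"
proof -
  have "continuous_map X (prod_topology E euclidean) (\<lambda>x. (sec T x, c))"
    using assms by (intro continuous_map_pairedI) auto
  from continuous_map_compose[OF this A2] show ?thesis
    by (rule continuous_map_eq) (simp add: proj_sec sec_scaleC[OF _ assms(1,1)] assms)
qed

lemma poly_in_op_alg: "T \<in> poly_alg \<Longrightarrow> T \<in> op_alg"
  unfolding op_alg_def using closure_subset by blast

lemma word_op_in_op_alg: "word_op w \<in> op_alg"
  by (intro poly_in_op_alg) (simp add: poly_alg_eq_span ell2_op.span_base)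

lemma creation_eq_word_op: "creation j = word_op [j]"
  by (auto intro!: blinfun_eqI)

text \<open>
  The empty word is excluded: its section is the unit section, whose continuity is not part of
  the definition of a bundle.
\<close>

lemma sec_word_op_continuous:
  "w \<noteq> [] \<Longrightarrow> continuous_map X E (sec (word_op w))"
proof (induction w rule: list_nonempty_induct)
  case (single j)
  have "sec (word_op [j]) = (\<lambda>x. \<theta> x (creation j +o closure (I x)))"
    unfolding creation_eq_word_op by (simp add: sec_def fun_eq_iff del: word_op.simps)
  then show ?case using creation_continuous[of j] by simp
next
  case (cons j w)
  have "continuous_map X E (sec (creation j))"
    using creation_continuous[of j] by (simp add: sec_def[abs_def])
  moreover have "creation j \<in> op_alg" using word_op_in_op_alg[of "[j]"] by (simp only: creation_eq_word_op)
  ultimately show ?case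
    using sec_mult_continuous[OF _ _ word_op_in_op_alg cons.IH] by simp
qed

lemma sec_homogeneous_continuous:
  assumes k: "k \<ge> 1" and T: "T \<in> poly_homog k"
  shows "continuous_map X E (sec T)"
proof -
  have "continuous_map X E (sec T) \<and> T \<in> op_alg"
    using T unfolding poly_homog_def
  proof (induction rule: ell2_op.span_induct_alt)
    case base
    \<comment> \<open>The zero section is 0 times the section of an arbitrary letter.\<close>
    let ?w = "[undefined] :: 'n list"
    have "continuous_map X E (sec (op_scaleC 0 (word_op ?w)))"
      by (intro sec_scaleC_continuous word_op_in_op_alg sec_word_op_continuous) simp
    moreover have "0 \<in> poly_alg" unfolding poly_alg_eq_span by (rule ell2_op.span_zero)
    ultimately show ?case using poly_in_op_alg by (simp del: word_op.simps)
  next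
    case (step c S T)
    then obtain w where w: "S = word_op w" "w \<noteq> []" using k by force
    have sub: "ell2_op.subspace (op_alg :: 'n fock_op set)"
      unfolding op_alg_def poly_alg_eq_span by (intro subspace_closure_op ell2_op.subspace_span)
    have S: "op_scaleC c S \<in> op_alg"
      using w word_op_in_op_alg ell2_op.subspace_scale[OF sub] by blast
    have "continuous_map X E (sec (op_scaleC c S))"
      unfolding w by (intro sec_scaleC_continuous word_op_in_op_alg sec_word_op_continuous w)
    then show ?case using step S sec_add_continuous ell2_op.subspace_add[OF sub] by blast
  qed
  then show ?thesis ..
qed

text \<open>
  For \<open>k \<ge> 1\<close> the function is the norm of a continuous section; for \<open>k = 0\<close> it is constant.
\<close>

lemma norm_ideal_proj_continuous:
  assumes f: "f \<in> fock_homog k"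
  shows "continuous_map X euclideanreal (\<lambda>x. norm (ideal_proj (I x) f))"
proof (cases "k = 0")
  case True
  have "continuous_map X euclideanreal (\<lambda>x. norm f)" by simp
  then show ?thesis
    by (rule continuous_map_eq) (use ideal_proj_homogeneous(3)[OF graded f True] in simp)
next
  case False
  obtain T where T: "T \<in> poly_homog k" "f = Ev T" using f by (auto simp: fock_homog_eq_Ev)
  have TA: "T \<in> op_alg" using T(1) poly_homog_subset by (blast intro: poly_in_op_alg)
  have "continuous_map X euclideanreal ((\<lambda>e. nrm (A (\<pi> e)) e) \<circ> sec T)"
    by (intro continuous_map_compose[OF _ A5] sec_homogeneous_continuous[OF _ T(1)])
       (use False in simp)
  then show ?thesis
  proof (rule continuous_map_eq)
    fix x assume x: "x \<in> topspace X"
    have "nrm (A x) (sec T x) = nrm (quotient_alg (I x)) (T +o closure (I x))"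
      using iso[OF x] coset_in_carr[OF TA] unfolding sec_def isometric_isomorphism_def by simp
    then show "((\<lambda>e. nrm (A (\<pi> e)) e) \<circ> sec T) x = norm (ideal_proj (I x) f)"
      using quotient_norm_homogeneous[OF graded[OF x] T(1)] by (simp add: proj_sec[OF x TA] T(2))
  qed
qed

lemma ideal_proj_continuous: "continuous_map X ideal_proj_space (\<lambda>x. ideal_proj (I x))"
proof -
  have "continuous_map X euclidean (\<lambda>x. ideal_proj (I x) f)" for f
    unfolding continuous_map_atin limitin_canonical_iff
  proof (rule ballI, rule tendsto_contractions_of_kets)
    show "norm (ideal_proj (I x) f) \<le> norm f" for x f
      by (rule norm_orth_proj_le[OF is_orth_proj_ideal_proj])
    then show "norm (ideal_proj (I x) f) \<le> norm f" for x f .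
    fix x c and w :: "'n list" assume x: "x \<in> topspace X"
    have ket: "scaleC c (ket w) \<in> fock_homog (length w)"
      using ket_in_fock_homog subspace_fock_homog by (rule ell2.subspace_scale[rotated])
    show "((\<lambda>y. ideal_proj (I y) (scaleC c (ket w)))
        \<longlongrightarrow> ideal_proj (I x) (scaleC c (ket w))) (atin X x)"
    proof (rule tendsto_orth_proj[OF is_orth_proj_ideal_proj is_orth_proj_ideal_proj
            _ subspace_fock_homog ket ideal_proj_homogeneous(1)[OF graded[OF x] ket]])
      fix g :: "'n fock" assume "g \<in> fock_homog (length w)"
      from norm_ideal_proj_continuous[OF this] x
      show "((\<lambda>y. norm (ideal_proj (I y) g)) \<longlongrightarrow> norm (ideal_proj (I x) g)) (atin X x)"
        unfolding continuous_map_atin limitin_canonical_iff by blast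
    qed
  qed
  then have "continuous_map X strong_operator_topology (\<lambda>x. ideal_proj (I x))"
    by (simp add: continuous_on_strong_operator_topo_iff_coordinatewise)
  then show ?thesis
    unfolding ideal_proj_space_def continuous_map_in_subtopology
    using graded by auto
qed

end

theorem theorem7:
  fixes E :: "'e topology" and X :: "'x topology" and \<pi> :: "'e \<Rightarrow> 'x"
    and A :: "'x \<Rightarrow> 'e normed_alg"
    and I :: "'x \<Rightarrow> ('n :: finite) fock_op set"
    and \<theta> :: "'x \<Rightarrow> 'n fock_op set \<Rightarrow> 'e"
  assumes "banach_algebra_bundle E X \<pi> A"
    and "\<And>x. x \<in> topspace X \<Longrightarrow> graded_ideal (I x)"
    and "\<And>x. x \<in> topspace X \<Longrightarrow> isometric_isomorphism (quotient_alg (I x)) (A x) (\<theta> x)"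
    and "\<And>i. continuous_map X E (\<lambda>x. \<theta> x (creation i +o closure (I x)))"
  shows "continuous_map X ideal_proj_space (\<lambda>x. ideal_proj (I x))"
proof -
  interpret quotient_bundle E X \<pi> A I \<theta>
    by (rule quotient_bundle.intro[OF assms(1)], rule quotient_bundle_axioms.intro)
       (fact assms(2), fact assms(3), fact assms(4))
  show ?thesis by (rule ideal_proj_continuous)
qed

end
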